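(* Let $a>b\ge1$ be integers with $\gcd(a,b)=1$. After deleting finitely many initial terms, each of the sequences $(a^n-b^n)_{n\ge1}$ and $(a^n+b^n)_{n\ge1}$ is neither $L^\infty$-Khintchin nor $L^1$-Khintchin. In particular, the sequence $(2^n+1)_{n\ge1}$ is neither $L^\infty$-Khintchin nor $L^1$-Khintchin.
   Context: $\mathbb{T}=\mathbb{R}/\mathbb{Z}$ is the circle group with its Haar probability measure $m$. For a sequence $\lambda=(\lambda_n)_{n\ge1}$ of positive integers and a measurable function $g$ on $\mathbb{T}$, put $A_N^\lambda g(x)=\frac1N\sum_{n\le N}g(\lambda_n x)$, $x\in\mathbb{T}$. For $1\le q\le\infty$, the sequence $\lambda$ is called $L^q$-Khintchin if, for every $g\in L^q(\mathbb{T})$, $A_N^\lambda g(x)\to\int_{\mathbb{T}}g\,dm$ as $N\to\infty$ for $m$-a.e. $x\in\mathbb{T}$. Deleting finitely many initial terms means replacing $(\lambda_n)_{n\ge1}$ by $(\lambda_{n+h})_{n\ge1}$ for some integer $h\ge0$. *)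

theory Defs
  imports "HOL-Probability.Probability"
begin

text \<open>The circle group \<open>\<real>/\<int>\<close> is modelled on the fundamental domain \<open>[0,1)\<close>: a point is
  given by its representative in \<open>[0,1)\<close>, and \<open>frac\<close> is the quotient map \<open>\<real> \<rightarrow> \<real>/\<int>\<close>.
  Lebesgue measure on \<open>[0,1)\<close> is then the Haar probability measure; see
  \<open>prob_space_circle\<close> and \<open>circle_translation_invariant\<close> below.\<close>

definition circle :: "real measure" where
  "circle = restrict_space lborel {0..<1}"

definition circle_mult :: "nat \<Rightarrow> real \<Rightarrow> real" where
  "circle_mult k x = frac (real k * x)"

definition in_Lq :: "ennreal \<Rightarrow> (real \<Rightarrow> complex) \<Rightarrow> bool" where
  "in_Lq q g \<longleftrightarrow> g \<in> borel_measurable circle \<and>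
     (if q = \<infinity> then \<exists>C::real. AE x in circle. norm (g x) \<le> C
      else integrable circle (\<lambda>x. norm (g x) powr enn2real q))"

text \<open>Sequences \<open>(\<lambda>\<^sub>n)\<close> are indexed by \<open>n \<ge> 1\<close>; the value at index 0 is never used.\<close>

definition ergodic_avg :: "(nat \<Rightarrow> nat) \<Rightarrow> (real \<Rightarrow> complex) \<Rightarrow> nat \<Rightarrow> real \<Rightarrow> complex" where
  "ergodic_avg lam g N x = (\<Sum>n=1..N. g (circle_mult (lam n) x)) / of_nat N"

text \<open>Meaningful for \<open>1 \<le> q \<le> \<infinity>\<close> and sequences of positive integers.\<close>

definition Khintchin :: "ennreal \<Rightarrow> (nat \<Rightarrow> nat) \<Rightarrow> bool" where
  "Khintchin q lam \<longleftrightarrow> (\<forall>g. in_Lq q g \<longrightarrow>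
     (AE x in circle. (\<lambda>N. ergodic_avg lam g N x) \<longlonglongrightarrow> (\<integral>y. g y \<partial>circle)))"

definition delete_initial :: "nat \<Rightarrow> (nat \<Rightarrow> nat) \<Rightarrow> nat \<Rightarrow> nat" where
  "delete_initial h lam = (\<lambda>n. lam (n + h))"

lemma space_circle [simp]: "space circle = {0..<1}"
  by (simp add: circle_def space_restrict_space)

lemma sets_circle: "A \<in> sets circle \<longleftrightarrow> A \<in> sets borel \<and> A \<subseteq> {0..<1}"
  by (auto simp: circle_def sets_restrict_space_iff)

lemma emeasure_circle: "A \<in> sets circle \<Longrightarrow> emeasure circle A = emeasure lborel A"
  by (auto simp: circle_def emeasure_restrict_space sets_restrict_space_iff)

lemma prob_space_circle: "prob_space circle"
proof
  have "{0..<1::real} \<in> sets circle" by (simp add: sets_circle)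
  then show "emeasure circle (space circle) = 1" by (simp add: emeasure_circle)
qed

lemma measurable_circle_frac:
  assumes "f \<in> borel_measurable borel"
  shows "(\<lambda>x. frac (f x :: real)) \<in> measurable circle circle"
proof -
  have 1: "f \<in> borel_measurable circle"
    unfolding circle_def by (intro measurable_restrict_space1) (use assms in simp)
  then have "(\<lambda>x. frac (f x)) \<in> borel_measurable circle"
    unfolding frac_def by measurable
  then show ?thesis
    by (subst (2) circle_def, intro measurable_restrict_space2) (auto simp: frac_ge_0 frac_lt_1)
qed

lemma circle_translation_invariant: "distr circle circle (\<lambda>x. frac (x + t)) = circle"
proof (rule measure_eqI)
  fix A assume "A \<in> sets (distr circle circle (\<lambda>x. frac (x + t)))"
  then have A: "A \<in> sets circle" by simp
  then have AB [measurable]: "A \<in> sets borel" and A01: "A \<subseteq> {0..<1}" by (auto simp: sets_circle)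
  define s where "s = frac t"
  have s: "0 \<le> s" "s < 1" by (auto simp: s_def frac_lt_1)
  have fr: "frac (x + t) = (if x < 1 - s then x + s else x + s - 1)" if "x \<in> {0..<1}" for x
    using that frac_add[of x t] by (auto simp: s_def[symmetric] frac_eq[THEN iffD2])
  have meas: "(\<lambda>x. frac (x + t)) \<in> measurable circle circle"
    by (rule measurable_circle_frac) simp
  have eq: "(\<lambda>x. frac (x + t)) -` A \<inter> space circle
      = (\<lambda>x. x + s) -` (A \<inter> {s..}) \<union> (\<lambda>x. x + (s - 1)) -` (A \<inter> {..<s})"
  proof (rule set_eqI)
    fix x
    have "x \<in> (\<lambda>x. frac (x + t)) -` A \<inter> space circle
        \<longleftrightarrow> x \<in> {0..<1} \<and> (if x < 1 - s then x + s else x + s - 1) \<in> A"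
      using fr[of x] by auto
    also have "\<dots> \<longleftrightarrow> x + s \<in> A \<and> s \<le> x + s \<or> x + s - 1 \<in> A \<and> x + s - 1 < s"
      using s subsetD[OF A01, of "x + s"] subsetD[OF A01, of "x + s - 1"]
      by (cases "x < 1 - s"; cases "x + s \<in> A"; cases "x + s - 1 \<in> A") auto
    finally show "x \<in> (\<lambda>x. frac (x + t)) -` A \<inter> space circle \<longleftrightarrow>
        x \<in> (\<lambda>x. x + s) -` (A \<inter> {s..}) \<union> (\<lambda>x. x + (s - 1)) -` (A \<inter> {..<s})"
      by (auto simp: algebra_simps)
  qed
  have tr: "emeasure lborel ((\<lambda>x. x + c) -` B) = emeasure lborel B" if "B \<in> sets borel" for B and c :: real
  proof -
    have "emeasure lborel B = emeasure (distr lborel borel ((+) c)) B" using lborel_distr_plus[of c] by simp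
    also have "\<dots> = emeasure lborel ((+) c -` B \<inter> space lborel)" using that by (subst emeasure_distr) auto
    finally show ?thesis by (simp add: vimage_def add.commute)
  qed
  have "emeasure (distr circle circle (\<lambda>x. frac (x + t))) A
      = emeasure circle ((\<lambda>x. frac (x + t)) -` A \<inter> space circle)"
    using meas A by (rule emeasure_distr)
  also have "\<dots> = emeasure lborel ((\<lambda>x. frac (x + t)) -` A \<inter> space circle)"
    using meas A by (intro emeasure_circle measurable_sets)
  also have "\<dots> = emeasure lborel ((\<lambda>x. x + s) -` (A \<inter> {s..})) + emeasure lborel ((\<lambda>x. x + (s - 1)) -` (A \<inter> {..<s}))"
    unfolding eq
  proof (rule plus_emeasure[symmetric])
    have m: "(\<lambda>x::real. x + c) -` B \<in> sets lborel" if "B \<in> sets borel" for B c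
      using measurable_sets[of "\<lambda>x::real. x + c" borel borel B] that by simp
    show "(\<lambda>x. x + s) -` (A \<inter> {s..}) \<in> sets lborel" by (rule m) simp
    show "(\<lambda>x. x + (s - 1)) -` (A \<inter> {..<s}) \<in> sets lborel" by (rule m) simp
  next
    show "(\<lambda>x. x + s) -` (A \<inter> {s..}) \<inter> (\<lambda>x. x + (s - 1)) -` (A \<inter> {..<s}) = {}"
    proof -
      have False if "x + s \<in> A" "x + (s - 1) \<in> A" for x
        using subsetD[OF A01 that(1)] subsetD[OF A01 that(2)] by simp
      then show ?thesis by blast
    qed
  qed
  also have "\<dots> = emeasure lborel (A \<inter> {s..}) + emeasure lborel (A \<inter> {..<s})"
    by (simp only: tr AB sets.Int borel_closed closed_atLeast borel_open open_lessThan)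
  also have "\<dots> = emeasure lborel ((A \<inter> {s..}) \<union> (A \<inter> {..<s}))"
    by (rule plus_emeasure) auto
  also have "(A \<inter> {s..}) \<union> (A \<inter> {..<s}) = A" by auto
  finally show "emeasure (distr circle circle (\<lambda>x. frac (x + t))) A = emeasure circle A"
    by (simp add: emeasure_circle A)
qed simp

lemma ergodic_avg_delete_initial:
  "(\<lambda>N. ergodic_avg (delete_initial h lam) g N x) \<longlonglongrightarrow> L \<longleftrightarrow> (\<lambda>N. ergodic_avg lam g N x) \<longlonglongrightarrow> L"
proof -
  define c where "c = (\<Sum>n=1..h. g (circle_mult (lam n) x))"
  let ?S = "\<lambda>N. \<Sum>n=1..N. g (circle_mult (lam n) x)"
  let ?D = "\<lambda>N. \<Sum>n=1..N. g (circle_mult (lam (n + h)) x)"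
  have D: "?D N + c = ?S (N + h)" for N
  proof -
    have "?D N = (\<Sum>n=1+h..N+h. g (circle_mult (lam n) x))"
      by (subst sum.shift_bounds_cl_nat_ivl) simp
    moreover have "{1..N+h} = {1..h} \<union> {1+h..N+h}" by auto
    ultimately show ?thesis
      by (simp add: c_def sum.union_disjoint add.commute)
  qed
  have r: "(\<lambda>N. of_nat (N + h) / of_nat N :: complex) \<longlonglongrightarrow> 1"
  proof -
    have "(\<lambda>N. 1 + of_nat h * (1 / of_nat N) :: complex) \<longlonglongrightarrow> 1 + of_nat h * 0"
      by (intro tendsto_intros lim_1_over_n)
    moreover have "eventually (\<lambda>N. 1 + of_nat h * (1 / of_nat N) = (of_nat (N + h) / of_nat N :: complex)) sequentially"
      using eventually_gt_at_top[of 0] by eventually_elim (simp add: field_simps)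
    ultimately show ?thesis by (simp add: tendsto_cong)
  qed
  have c0: "(\<lambda>N. c / of_nat N) \<longlonglongrightarrow> 0"
    using tendsto_mult[OF tendsto_const[of c] lim_1_over_n] by simp
  have A: "ergodic_avg (delete_initial h lam) g N x = ?D N / of_nat N" for N
    by (simp add: ergodic_avg_def delete_initial_def)
  have B: "ergodic_avg lam g (N + h) x = ?S (N + h) / of_nat (N + h)" for N
    by (simp add: ergodic_avg_def)
  have "(\<lambda>N. ergodic_avg (delete_initial h lam) g N x) \<longlonglongrightarrow> L"
    if "(\<lambda>N. ergodic_avg lam g (N + h) x) \<longlonglongrightarrow> L"
  proof -
    have "(\<lambda>N. ergodic_avg lam g (N + h) x * (of_nat (N + h) / of_nat N) - c / of_nat N) \<longlonglongrightarrow> L * 1 - 0"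
      by (intro tendsto_intros that r c0)
    moreover have "eventually (\<lambda>N. ergodic_avg lam g (N + h) x * (of_nat (N + h) / of_nat N) - c / of_nat N
        = ergodic_avg (delete_initial h lam) g N x) sequentially"
      using eventually_gt_at_top[of 0]
    proof eventually_elim
      case (elim N)
      have "(of_nat (N + h) :: complex) \<noteq> 0" using elim by (simp del: of_nat_add)
      then show ?case unfolding A B D[symmetric]
        by (simp add: add_divide_distrib[symmetric] diff_divide_distrib[symmetric] del: of_nat_add)
    qed
    ultimately show ?thesis by (simp add: tendsto_cong)
  qed
  moreover have "(\<lambda>N. ergodic_avg lam g (N + h) x) \<longlonglongrightarrow> L"
    if "(\<lambda>N. ergodic_avg (delete_initial h lam) g N x) \<longlonglongrightarrow> L"
  proof -
    have "(\<lambda>N. (ergodic_avg (delete_initial h lam) g N x + c / of_nat N) / (of_nat (N + h) / of_nat N)) \<longlonglongrightarrow> (L + 0) / 1"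
      by (intro tendsto_intros that r c0) simp
    moreover have "eventually (\<lambda>N. (ergodic_avg (delete_initial h lam) g N x + c / of_nat N) / (of_nat (N + h) / of_nat N)
        = ergodic_avg lam g (N + h) x) sequentially"
      using eventually_gt_at_top[of 0]
    proof eventually_elim
      case (elim N)
      have "(of_nat (N + h) :: complex) \<noteq> 0" using elim by (simp del: of_nat_add)
      with elim show ?case unfolding A B D[symmetric] by (simp add: add_divide_distrib[symmetric] del: of_nat_add)
    qed
    ultimately show ?thesis by (simp add: tendsto_cong)
  qed
  ultimately show ?thesis
    using LIMSEQ_ignore_initial_segment[of "\<lambda>N. ergodic_avg lam g N x" L h]
      LIMSEQ_offset[of "\<lambda>N. ergodic_avg lam g N x" h L] by blast
qed

text \<open>The Khintchin property does not see finitely many terms, so ``for some \<open>h\<close>'' and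
  ``for every \<open>h\<close>'' amount to the same.\<close>

lemma Khintchin_delete_initial: "Khintchin q (delete_initial h lam) \<longleftrightarrow> Khintchin q lam"
  by (simp add: Khintchin_def ergodic_avg_delete_initial)

end

theory Submission
  imports Defs "HOL-Number_Theory.Number_Theory" "HOL-Real_Asymp.Real_Asymp"
begin

text \<open>
  The averages fail because the operators \<open>g \<mapsto> g(\<lambda>\<^sub>n x)\<close>, for \<open>n\<close> in a set of indices of positive
  density, act like independent commuting shifts, and such shifts admit no maximal inequality.

  Arithmetic input. If every prime factor of \<open>a\<^sup>n - b\<^sup>n\<close> already divided some earlier \<open>a\<^sup>m - b\<^sup>m\<close>,
  then lifting the exponent would show that \<open>a\<^sup>n - b\<^sup>n\<close> divides
  \<open>n (a + b) \<Prod>\<^sub>q (a\<^bsup>n/q\<^esup> - b\<^bsup>n/q\<^esup>)\<close>, with \<open>q\<close> ranging over the primes dividing \<open>n\<close>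
  (\<open>primitive_prime_or_dvd\<close>). When \<open>\<Sum>\<^sub>q 1/q \<le> 7/8\<close> this product is too small for large \<open>n\<close>, so a new
  prime exists (\<open>primitive_prime_exists\<close>). The odd part of \<open>\<Sum>\<^sub>q 1/q\<close> has mean at most \<open>1/4\<close>, so by
  Markov's inequality a positive proportion of indices qualifies. This density version replaces
  Zsigmondy's theorem. A primitive prime of \<open>a\<^bsup>2n\<^esup> - b\<^bsup>2n\<^esup>\<close> is a new prime for \<open>a\<^sup>n + b\<^sup>n\<close>.

  Combinatorial model. New primes make the \<open>\<lambda>\<^sub>n\<close>, \<open>n \<in> D\<close>, multiplicatively independent, so they
  can be coloured at will. Cut an initial part of \<open>D\<close> into \<open>K\<close> successive blocks, each holding a fixed
  proportion of all indices up to its end, and give the numbers \<open>\<lambda>\<^sub>n\<close> of the \<open>j\<close>-th block the colour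
  \<open>j\<close> modulo \<open>K\<close>. Let \<open>S\<close> be one colour class in a large box of monomials. Any monomial \<open>m\<close> inside the
  box can be moved into \<open>S\<close> through division by an arbitrary \<open>\<lambda>\<^sub>n\<close> of a suitable block, although \<open>S\<close>
  has only about a \<open>1/K\<close> share of the box (\<open>multiplicative_sweeping\<close>).

  Transfer to the circle. For a suitable short interval \<open>B\<close>, the sets \<open>{x. m x \<in> B}\<close> with \<open>m\<close> in the
  box are pairwise disjoint and of equal measure (\<open>multiplicative_tower\<close>), which copies the model to
  the circle. The copy is a small part of the circle. Multiplication by powers of a base \<open>q\<close> commutes
  with the averages and makes preimages independent, as digits in base \<open>q\<close> are; uniting such
  preimages gives a set \<open>E\<close> of measure at most \<open>\<epsilon>\<close> that is visited with frequency at least \<open>\<delta>/2\<close>,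
  at some late time, from half of the circle (\<open>sweeping_half_circle\<close>). For the union of such sets with
  summable \<open>\<epsilon>\<close>, the averages of the indicator exceed its integral by a fixed amount infinitely often
  on a set of positive measure. One bounded function thus disproves the Khintchin property for every exponent.
\<close>

section \<open>Primitive prime divisors of \<open>a\<^sup>n - b\<^sup>n\<close>\<close>

lemma geometric_cofactor_cong:
  fixes x y p :: int
  assumes "[x = y] (mod p)"
  shows "[(\<Sum>i<n. y ^ (n - Suc i) * x ^ i) = int n * y ^ (n - 1)] (mod p)"
proof -
  have "[(\<Sum>i<n. y ^ (n - Suc i) * x ^ i) = (\<Sum>i<n. y ^ (n - Suc i) * y ^ i)] (mod p)"
    by (intro cong_sum cong_mult cong_pow assms cong_refl)
  also have "(\<Sum>i<n. y ^ (n - Suc i) * y ^ i) = (\<Sum>i<n. y ^ (n - 1))"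
    by (intro sum.cong) (auto simp flip: power_add)
  finally show ?thesis by simp
qed

text \<open>Writing \<open>x = y + p z\<close>, the first-order terms sum to \<open>p z y\<^bsup>p-2\<^esup> \<Sum>i<p. i\<close>. For odd \<open>p\<close> the inner
  sum \<open>p (p - 1) / 2\<close> is itself a multiple of \<open>p\<close>; this is what makes \<open>p = 2\<close> exceptional.\<close>

lemma geometric_cofactor_cong_square:
  fixes x y p :: int
  assumes "[x = y] (mod p)" "odd p" "p > 0"
  shows "[(\<Sum>i<nat p. y ^ (nat p - Suc i) * x ^ i) = p * y ^ (nat p - 1)] (mod p\<^sup>2)"
proof -
  define n where "n = nat p"
  have p: "p = int n" and n: "odd n" using assms by (auto simp: n_def even_nat_iff)
  obtain z where z: "x = y + p * z"
    using assms(1) by (metis cong_iff_lin cong_sym mult.commute)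
  have term_cong: "[y ^ (n - Suc i) * x ^ i = y ^ (n - 1) + p * z * y ^ (n - 2) * int i] (mod p\<^sup>2)"
    if "i < n" for i
  proof -
    have pow: "[x ^ i = y ^ i + int i * (p * z) * y ^ (i - 1)] (mod p\<^sup>2)"
    proof (induction i)
      case (Suc i)
      have "[x ^ Suc i = (y + p * z) * (y ^ i + int i * (p * z) * y ^ (i - 1))] (mod p\<^sup>2)"
        using cong_mult[OF cong_refl[of x] Suc] by (simp add: z)
      moreover have "(y + p * z) * (y ^ i + int i * (p * z) * y ^ (i - 1))
          = y ^ Suc i + int (Suc i) * (p * z) * y ^ (Suc i - 1) + p\<^sup>2 * (z\<^sup>2 * int i * y ^ (i - 1))"
        by (cases i) (auto simp: algebra_simps power2_eq_square)
      ultimately show ?case by (simp add: cong_def)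
    qed auto
    have "[y ^ (n - Suc i) * x ^ i = y ^ (n - Suc i) * (y ^ i + int i * (p * z) * y ^ (i - 1))] (mod p\<^sup>2)"
      by (intro cong_mult cong_refl pow)
    also have "y ^ (n - Suc i) * (y ^ i + int i * (p * z) * y ^ (i - 1))
        = y ^ (n - 1) + p * z * y ^ (n - 2) * int i"
    proof (cases i)
      case (Suc j)
      have "n - 1 = (n - Suc i) + i" "n - 2 = (n - Suc i) + j" using that Suc by auto
      then have "y ^ (n - 1) = y ^ (n - Suc i) * y ^ i" "y ^ (n - 2) = y ^ (n - Suc i) * y ^ j"
        by (metis power_add)+
      then show ?thesis using Suc by (simp add: algebra_simps)
    qed auto
    finally show ?thesis .
  qed
  have "[(\<Sum>i<n. y ^ (n - Suc i) * x ^ i) = (\<Sum>i<n. y ^ (n - 1) + p * z * y ^ (n - 2) * int i)] (mod p\<^sup>2)"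
    by (intro cong_sum term_cong) auto
  also have "(\<Sum>i<n. y ^ (n - 1) + p * z * y ^ (n - 2) * int i)
      = p * y ^ (n - 1) + p * z * y ^ (n - 2) * (\<Sum>i<n. int i)"
    by (simp add: sum.distrib sum_distrib_left p)
  also have "(\<Sum>i<n. int i) = p * ((int n - 1) div 2)"
  proof -
    have "2 * (\<Sum>i<m. int i) = int m * (int m - 1)" for m :: nat
      by (induction m) (auto simp: algebra_simps)
    from this[of n] have "2 * (\<Sum>i<n. int i) = int n * (int n - 1)" .
    moreover obtain k where "n = 2 * k + 1" using n by (elim oddE)
    ultimately show ?thesis by (simp add: p del: sum.lessThan_Suc)
  qed
  also have "p * y ^ (n - 1) + p * z * y ^ (n - 2) * (p * ((int n - 1) div 2))
      = p * y ^ (n - 1) + p\<^sup>2 * (z * y ^ (n - 2) * ((int n - 1) div 2))"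
    by (simp add: algebra_simps power2_eq_square)
  finally show ?thesis
    unfolding n_def[symmetric] by (simp only: cong_def mod_mult_self2)
qed

lemma multiplicity_of_nat: "multiplicity (int p) (int x) = multiplicity p x"
  by (simp add: multiplicity_def flip: of_nat_power)

text \<open>For even \<open>m\<close> the sum of two odd squares is \<open>2\<close> modulo \<open>4\<close>; for odd \<open>m\<close> the cofactor of \<open>a + b\<close> is a
  sum of \<open>m\<close> odd terms. In both cases the bound does not depend on \<open>m\<close>.\<close>

lemma multiplicity_power_sum_two:
  fixes a b :: nat
  assumes "odd a" "odd b"
  shows "multiplicity 2 (a ^ m + b ^ m) \<le> multiplicity 2 (a + b)"
proof (cases "even m")
  case True
  then obtain k where k: "m = 2 * k" by (elim evenE)
  have sq: "z\<^sup>2 mod 4 = 1" if "odd z" for z :: nat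
  proof -
    obtain j where "z = 2 * j + 1" using \<open>odd z\<close> by (rule oddE)
    then have "z\<^sup>2 = 1 + 4 * (j\<^sup>2 + j)" by (simp add: power2_eq_square algebra_simps)
    then show ?thesis by simp
  qed
  have "a ^ m = (a ^ k)\<^sup>2" "b ^ m = (b ^ k)\<^sup>2" by (simp_all add: k mult.commute flip: power_mult)
  then have "(a ^ m + b ^ m) mod 4 = 2"
    using sq[of "a ^ k"] sq[of "b ^ k"] assms by (simp add: mod_add_eq[symmetric, of "(a^k)\<^sup>2"])
  then have "\<not> 2 ^ 2 dvd a ^ m + b ^ m" by (auto simp: dvd_eq_mod_eq_0)
  then have "multiplicity 2 (a ^ m + b ^ m) < 2"
    by (rule multiplicity_lessI[rotated 2]) (use assms in \<open>auto simp: odd_pos\<close>)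
  moreover have "multiplicity 2 (a + b) \<ge> 1"
    using assms by (intro multiplicity_geI) auto
  ultimately show ?thesis by linarith
next
  case False
  let ?S = "\<Sum>i<m. (- int b) ^ (m - Suc i) * int a ^ i"
  have "int (a ^ m + b ^ m) = int a ^ m - (- int b) ^ m" using False by simp
  also have "\<dots> = int (a + b) * ?S" by (subst power_diff_sumr2) simp
  finally have eq: "int (a ^ m + b ^ m) = int (a + b) * ?S" .
  have "[int a = - int b] (mod 2)" using assms by (auto simp: cong_iff_dvd_diff)
  from geometric_cofactor_cong[OF this, of m] have "odd ?S"
    using False assms by (auto simp: cong_def mod2_eq_if split: if_splits)
  moreover have "int (a + b) \<noteq> 0" using odd_pos[OF assms(1)] by simp
  ultimately have "multiplicity 2 (int (a ^ m + b ^ m)) = multiplicity 2 (int (a + b))"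
    unfolding eq
    by (subst prime_elem_multiplicity_mult_distrib)
       (auto simp: not_dvd_imp_multiplicity_0 simp del: of_nat_add)
  then show ?thesis
    using multiplicity_of_nat[of 2 "a ^ m + b ^ m"] multiplicity_of_nat[of 2 "a + b"] by simp
qed

text \<open>Lifting the exponent, as a bound valid for every prime: the cofactor
  \<open>(x\<^sup>q - y\<^sup>q) / (x - y)\<close> is \<open>q y\<^bsup>q-1\<^esup>\<close> modulo \<open>p\<close>, so it can contain \<open>p\<close> only if \<open>p = q\<close>, and then exactly
  once if \<open>p\<close> is odd. The summand with \<open>a + b\<close> pays for \<open>p = q = 2\<close>, where the cofactor is \<open>x + y\<close>.\<close>

lemma multiplicity_power_diff_le:
  fixes a b p q m :: nat
  assumes "a > b" "b \<ge> 1" "coprime a b" "prime p" "prime q" "m > 0" and dvd: "p dvd a ^ m - b ^ m"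
  shows "multiplicity p (a ^ (m * q) - b ^ (m * q))
    \<le> multiplicity p (a ^ m - b ^ m) + multiplicity p q + multiplicity p (a + b)"
proof -
  define x y where "x = a ^ m" and "y = b ^ m"
  have less: "y < x" unfolding x_def y_def using assms by (intro power_strict_mono) auto
  have pos: "0 < y" "0 < x" using assms by (auto simp: x_def y_def)
  have q: "q \<ge> 2" using assms by (simp add: prime_ge_2_nat)
  have less': "y ^ q < x ^ q" using less q by (intro power_strict_mono) auto
  have py: "\<not> p dvd y"
  proof
    assume "p dvd y"
    then have "p dvd x" using dvd less by (metis dvd_diffD less_imp_le x_def y_def)
    moreover have "coprime x y" using assms by (simp add: x_def y_def)
    ultimately show False using \<open>p dvd y\<close> assms(4) by (meson coprime_common_divisor not_prime_unit)
  qed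
  have cong: "[int x = int y] (mod int p)"
    using dvd less unfolding x_def[symmetric] y_def[symmetric]
    by (metis cong_iff_dvd_diff int_dvd_int_iff less_imp_le of_nat_diff)
  define S where "S = (\<Sum>i<q. int y ^ (q - Suc i) * int x ^ i)"
  have eq: "int (x ^ q - y ^ q) = int (x - y) * S"
    using less less' by (simp add: of_nat_diff S_def power_diff_sumr2)
  have S0: "S > 0"
  proof -
    have "x ^ q - y ^ q > 0" "x - y > 0" using less less' by auto
    then have "int (x ^ q - y ^ q) > 0" "int (x - y) > 0" by linarith+
    then show ?thesis unfolding eq by (simp add: zero_less_mult_iff)
  qed
  have "multiplicity (int p) S \<le> multiplicity p q + multiplicity p (a + b)"
  proof (cases "p = q")
    case False
    have "[S = int q * int y ^ (q - 1)] (mod int p)"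
      unfolding S_def by (rule geometric_cofactor_cong[OF cong])
    moreover have "\<not> p dvd q * y ^ (q - 1)"
      using False py assms by (auto simp: prime_dvd_mult_iff primes_dvd_imp_eq dest: prime_dvd_power)
    then have "\<not> int p dvd int q * int y ^ (q - 1)"
      by (metis int_dvd_int_iff of_nat_mult of_nat_power)
    ultimately have "\<not> int p dvd S" using cong_dvd_iff by blast
    then show ?thesis by (simp add: not_dvd_imp_multiplicity_0)
  next
    case pq: True
    show ?thesis
    proof (cases "p = 2")
      case True
      then have "odd x" "odd y" using py cong by (auto simp: cong_iff_dvd_diff)
      then have odd: "odd a" "odd b" using assms by (auto simp: x_def y_def)
      have "S = int (a ^ m + b ^ m)"
        using True pq by (simp add: S_def numeral_2_eq_2 x_def y_def)
      then have "multiplicity (int p) S = multiplicity 2 (a ^ m + b ^ m)"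
        using True multiplicity_of_nat[of 2 "a ^ m + b ^ m"] by simp
      then show ?thesis using multiplicity_power_sum_two[OF odd, of m] True by simp
    next
      case False
      then have "odd (int p)" using assms(4) by (simp add: prime_odd_nat prime_ge_2_nat order_less_le)
      then have "[S = int p * int y ^ (p - 1)] (mod (int p)\<^sup>2)"
        using geometric_cofactor_cong_square[OF cong] assms(4) by (simp add: S_def pq prime_gt_0_nat)
      moreover have "\<not> (int p)\<^sup>2 dvd int p * int y ^ (p - 1)"
      proof
        assume "(int p)\<^sup>2 dvd int p * int y ^ (p - 1)"
        then have "int p dvd int y ^ (p - 1)"
          using assms(4) by (auto simp: power2_eq_square prime_gt_0_nat)
        then have "p dvd y ^ (p - 1)" by (metis int_dvd_int_iff of_nat_power)
        then show False using py assms(4) prime_dvd_power by blast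
      qed
      ultimately have "\<not> (int p)\<^sup>2 dvd S" using cong_dvd_iff by blast
      then have "multiplicity (int p) S < 2"
        by (rule multiplicity_lessI[rotated 2]) (use S0 assms(4) in \<open>auto simp: prime_gt_1_nat\<close>)
      moreover have "multiplicity p q = 1" using pq assms(4) by (simp add: prime_gt_1_nat)
      ultimately show ?thesis by simp
    qed
  qed
  moreover have "multiplicity p (x ^ q - y ^ q) = multiplicity (int p) (int (x ^ q - y ^ q))"
    by (rule multiplicity_of_nat[symmetric])
  moreover have "\<dots> = multiplicity (int p) (int (x - y)) + multiplicity (int p) S"
    unfolding eq using S0 less assms(4)
    by (subst prime_elem_multiplicity_mult_distrib) auto
  moreover have "multiplicity (int p) (int (x - y)) = multiplicity p (x - y)"
    by (rule multiplicity_of_nat)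
  ultimately show ?thesis by (simp add: x_def y_def power_mult)
qed

text \<open>The exponents \<open>k\<close> with \<open>p\<close> dividing \<open>a\<^sup>k - b\<^sup>k\<close> are the multiples of the order \<open>e\<close> of \<open>a/b\<close> modulo
  \<open>p\<close>. If \<open>p\<close> is not primitive for \<open>n\<close>, then \<open>e\<close> is a proper divisor of \<open>n\<close>, hence divides \<open>n/q\<close> for some
  prime \<open>q\<close>, and lifting the exponent from \<open>n/q\<close> to \<open>n\<close> controls the power of \<open>p\<close>.\<close>

lemma primitive_prime_or_dvd:
  fixes a b n :: nat
  assumes ab: "a > b" "b \<ge> 1" "coprime a b" and n: "n > 0"
    and none: "\<nexists>p. prime p \<and> p dvd a ^ n - b ^ n \<and> (\<forall>m. 0 < m \<and> m < n \<longrightarrow> \<not> p dvd a ^ m - b ^ m)"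
  shows "a ^ n - b ^ n dvd n * (a + b) * (\<Prod>q\<in>prime_factors n. a ^ (n div q) - b ^ (n div q))"
proof (rule multiplicity_le_imp_dvd)
  have diff: "a ^ m - b ^ m > 0" if "m > 0" for m
    using power_strict_mono[of b a m] ab that by simp
  show "a ^ n - b ^ n \<noteq> 0" using diff[OF n] by simp
  have quot: "n div q > 0" if "q \<in> prime_factors n" for q
    using that n by (auto simp: div_greater_zero_iff dvd_imp_le prime_gt_0_nat in_prime_factors_iff)
  fix p :: nat assume p: "prime p"
  define R where "R = n * (a + b) * (\<Prod>q\<in>prime_factors n. a ^ (n div q) - b ^ (n div q))"
  have R0: "R \<noteq> 0" using n ab diff quot by (force simp: R_def)
  show "multiplicity p (a ^ n - b ^ n) \<le> multiplicity p R"
  proof (cases "p dvd a ^ n - b ^ n")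
    case True
    with none p obtain m where m: "0 < m" "m < n" "p dvd a ^ m - b ^ m" by blast
    have le: "b ^ k \<le> a ^ k" for k using ab by (intro power_mono) auto
    have pb: "coprime b p"
    proof (rule ccontr)
      assume "\<not> coprime b p"
      then have "p dvd b" using p by (metis coprime_commute prime_imp_coprime)
      then have "p dvd b ^ n" using n by (simp add: dvd_power_same dvd_trans[OF _ dvd_power])
      then have "p dvd a ^ n" using True le[of n] dvd_diffD by blast
      then have "p dvd a" using p prime_dvd_power by blast
      then show False using \<open>p dvd b\<close> ab p by (meson coprime_common_divisor not_prime_unit)
    qed
    then obtain c where c: "[b * c = 1] (mod p)" using cong_solve_coprime_nat by auto
    define e where "e = ord p (a * c)"
    have dvd_iff: "p dvd a ^ k - b ^ k \<longleftrightarrow> e dvd k" for k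
    proof -
      have "p dvd a ^ k - b ^ k \<longleftrightarrow> [a ^ k = b ^ k] (mod p)"
        using le[of k] by (simp add: cong_altdef_nat)
      also have "\<dots> \<longleftrightarrow> [a ^ k * c ^ k = b ^ k * c ^ k] (mod p)"
      proof -
        have "coprime c p" using c by (metis cong_imp_coprime cong_sym coprime_1_left coprime_mult_left_iff)
        then have "coprime (c ^ k) p" by simp
        then show ?thesis by (simp add: cong_mult_rcancel_nat)
      qed
      also have "\<dots> \<longleftrightarrow> [(a * c) ^ k = (b * c) ^ k] (mod p)" by (simp add: power_mult_distrib)
      also have "\<dots> \<longleftrightarrow> [(a * c) ^ k = 1] (mod p)"
        using cong_pow[OF c, of k] by (auto intro: cong_trans cong_sym simp: cong_def)
      finally show ?thesis unfolding e_def by (simp only: ord_divides)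
    qed
    have "e dvd n" "e dvd m" using True m dvd_iff by auto
    then have "e < n" using m by (meson dvd_imp_le le_less_trans)
    obtain t where t: "n = e * t" using \<open>e dvd n\<close> by (elim dvdE)
    then have "t \<noteq> 1" using \<open>e < n\<close> by auto
    then obtain q where q: "prime q" "q dvd t" using prime_factor_nat by blast
    then have qn: "q \<in> prime_factors n" using t n by (auto simp: in_prime_factors_iff)
    have nq: "n div q * q = n" using q t by auto
    have "e dvd n div q" using q t by (metis div_mult_swap dvd_triv_left)
    then have "p dvd a ^ (n div q) - b ^ (n div q)" using dvd_iff by blast
    from multiplicity_power_diff_le[OF ab p q(1) quot[OF qn] this]
    have "multiplicity p (a ^ n - b ^ n)
      \<le> multiplicity p (a ^ (n div q) - b ^ (n div q)) + multiplicity p q + multiplicity p (a + b)"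
      unfolding nq .
    also have "\<dots> = multiplicity p (q * (a + b) * (a ^ (n div q) - b ^ (n div q)))"
      using p q ab diff[OF quot[OF qn]] prime_gt_0_nat[OF q(1)]
      by (simp add: prime_elem_multiplicity_mult_distrib)
    also have "\<dots> \<le> multiplicity p R"
    proof (rule dvd_imp_multiplicity_le[OF _ R0])
      show "q * (a + b) * (a ^ (n div q) - b ^ (n div q)) dvd R"
        unfolding R_def using qn
        by (intro mult_dvd_mono dvd_refl dvd_prodI) auto
    qed
    finally show ?thesis .
  qed (simp add: not_dvd_imp_multiplicity_0)
qed

text \<open>The right-hand side of the divisibility is at most \<open>2 a n \<cdot> a\<^bsup>7n/8\<^esup>\<close>, while
  \<open>a\<^sup>n - b\<^sup>n \<ge> a\<^bsup>n-1\<^esup>\<close>.\<close>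

lemma primitive_prime_exists:
  fixes a b n :: nat
  assumes ab: "a > b" "b \<ge> 1" "coprime a b" and n: "n > 0"
    and sparse: "(\<Sum>q\<in>prime_factors n. 1 / real q) \<le> 7 / 8"
    and large: "2 * real a ^ 2 * real n < real a powr (real n / 8)"
  shows "\<exists>p. prime p \<and> p dvd a ^ n - b ^ n \<and> (\<forall>m. 0 < m \<and> m < n \<longrightarrow> \<not> p dvd a ^ m - b ^ m)"
proof (rule ccontr)
  assume "\<not> ?thesis"
  then have dvd: "a ^ n - b ^ n dvd n * (a + b) * (\<Prod>q\<in>prime_factors n. a ^ (n div q) - b ^ (n div q))"
    by (intro primitive_prime_or_dvd ab n) blast
  have a: "real a > 0" "real a \<ge> 1" using ab by auto
  have "real (\<Prod>q\<in>prime_factors n. a ^ (n div q) - b ^ (n div q))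
      \<le> (\<Prod>q\<in>prime_factors n. real a powr (real n * (1 / real q)))"
    unfolding of_nat_prod
  proof (intro prod_mono conjI)
    fix q assume "q \<in> prime_factors n"
    have "real (a ^ (n div q) - b ^ (n div q)) \<le> real a ^ (n div q)"
      by (metis diff_le_self of_nat_le_iff of_nat_power)
    also have "\<dots> = real a powr real (n div q)" using a by (simp add: powr_realpow)
    also have "\<dots> \<le> real a powr (real n * (1 / real q))"
      using a of_nat_div_le_of_nat[where 'a=real, of n q] by (intro powr_mono) auto
    finally show "real (a ^ (n div q) - b ^ (n div q)) \<le> real a powr (real n * (1 / real q))" .
  qed auto
  also have "\<dots> = real a powr (real n * (\<Sum>q\<in>prime_factors n. 1 / real q))"
    using a by (simp add: powr_sum sum_distrib_left)
  also have "\<dots> \<le> real a powr (real n * (7 / 8))"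
    using a sparse by (intro powr_mono mult_left_mono) auto
  finally have prod: "real (\<Prod>q\<in>prime_factors n. a ^ (n div q) - b ^ (n div q)) \<le> real a powr (real n * (7 / 8))" .
  have pos: "a ^ k - b ^ k > 0" if "k > 0" for k
    using power_strict_mono[of b a k] ab that by simp
  have "(\<Prod>q\<in>prime_factors n. a ^ (n div q) - b ^ (n div q)) > 0"
    by (intro prod_pos ballI pos)
       (use n in \<open>auto simp: div_greater_zero_iff dvd_imp_le prime_gt_0_nat in_prime_factors_iff\<close>)
  then have "a ^ n - b ^ n \<le> n * (a + b) * (\<Prod>q\<in>prime_factors n. a ^ (n div q) - b ^ (n div q))"
    using n ab by (intro dvd_imp_le[OF dvd]) auto
  then have "real (a ^ n - b ^ n) \<le> real n * real (a + b) * real (\<Prod>q\<in>prime_factors n. a ^ (n div q) - b ^ (n div q))"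
    by (metis of_nat_le_iff of_nat_mult)
  also have "\<dots> \<le> real n * (2 * real a) * real a powr (real n * (7 / 8))"
    using ab by (intro mult_mono prod mult_left_mono) (auto intro!: prod_nonneg)
  finally have upper: "real (a ^ n - b ^ n) \<le> real n * (2 * real a) * real a powr (real n * (7 / 8))" .
  have "a ^ n - b ^ n \<ge> a ^ (n - 1)"
  proof -
    obtain k where k: "n = Suc k" using n by (cases n) auto
    have "b ^ n \<le> (a - 1) * a ^ k" unfolding k power_Suc
      using ab by (intro mult_mono power_mono) auto
    moreover have "a ^ n = (a - 1) * a ^ k + a ^ k" using ab by (cases a) (auto simp: k)
    ultimately show ?thesis by (simp add: k)
  qed
  then have "real a ^ (n - 1) \<le> real (a ^ n - b ^ n)" by (metis of_nat_le_iff of_nat_power)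
  from order_trans[OF this upper]
  have "real a * real a ^ (n - 1) \<le> real a * (real n * (2 * real a) * real a powr (real n * (7 / 8)))"
    using a by (intro mult_left_mono) auto
  moreover have "real a * real a ^ (n - 1) = real a powr (real n / 8) * real a powr (real n * (7 / 8))"
  proof -
    have "real a * real a ^ (n - 1) = real a powr real n"
      using n a by (simp add: powr_realpow flip: power_Suc)
    also have "real n = real n / 8 + real n * (7 / 8)" by simp
    finally show ?thesis by (simp only: powr_add)
  qed
  ultimately have "real a powr (real n / 8) * real a powr (real n * (7 / 8))
    \<le> 2 * real a ^ 2 * real n * real a powr (real n * (7 / 8))"
    by (simp add: power2_eq_square mult_ac)
  then have "real a powr (real n / 8) \<le> 2 * real a ^ 2 * real n" using a by simp
  with large show False by simp
qed

section \<open>Density of indices with few small prime factors\<close>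

text \<open>The prime \<open>2\<close> is left out so that \<open>n\<close> and \<open>2 n\<close> have the same weight; it contributes at most
  \<open>1/2\<close> to the full sum in either case.\<close>

definition odd_prime_weight :: "nat \<Rightarrow> real" where
  "odd_prime_weight n = (\<Sum>q | q \<in> prime_factors n \<and> odd q. 1 / real q)"

lemma sum_inverse_prime_factors_le:
  "(\<Sum>q\<in>prime_factors n. 1 / real q) \<le> 1 / 2 + odd_prime_weight n"
proof -
  have "(\<Sum>q\<in>prime_factors n. 1 / real q) \<le> (\<Sum>q\<in>insert 2 {q \<in> prime_factors n. odd q}. 1 / real q)"
    by (intro sum_mono2) (auto simp: in_prime_factors_iff dest: primes_dvd_imp_eq[OF two_is_prime_nat])
  also have "\<dots> = 1 / 2 + odd_prime_weight n"
    by (subst sum.insert) (auto simp: odd_prime_weight_def)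
  finally show ?thesis .
qed

lemma odd_prime_weight_double: "n > 0 \<Longrightarrow> odd_prime_weight (2 * n) = odd_prime_weight n"
  unfolding odd_prime_weight_def
  by (intro sum.cong) (auto simp: prime_factors_product prime_prime_factors)

text \<open>An odd prime \<open>q\<close> divides at most \<open>N/q\<close> of the indices and adds \<open>1/q\<close> for each, so the mean weight is
  at most \<open>\<Sum> 1/(2k+1)\<^sup>2\<close> over \<open>k \<ge> 1\<close>, which a telescoping comparison bounds by \<open>1/4\<close>.\<close>

lemma sum_odd_prime_weight_le: "(\<Sum>n=1..N. odd_prime_weight n) \<le> real N / 4"
proof -
  let ?Q = "{q \<in> {1..N}. prime q \<and> odd q}"
  have "odd_prime_weight n = (\<Sum>q\<in>?Q. if q dvd n then 1 / real q else 0)" if "n \<in> {1..N}" for n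
  proof -
    have "q \<le> N" if "q dvd n" for q using that \<open>n \<in> {1..N}\<close> by (auto dest: dvd_imp_le)
    then have "{q. q \<in> prime_factors n \<and> odd q} = ?Q \<inter> {q. q dvd n}"
      using that by (auto simp: in_prime_factors_iff prime_ge_1_nat)
    then show ?thesis by (simp add: odd_prime_weight_def sum.inter_restrict)
  qed
  then have "(\<Sum>n=1..N. odd_prime_weight n) = (\<Sum>n=1..N. \<Sum>q\<in>?Q. if q dvd n then 1 / real q else 0)"
    by simp
  also have "\<dots> = (\<Sum>q\<in>?Q. \<Sum>n=1..N. if q dvd n then 1 / real q else 0)" by (rule sum.swap)
  also have "\<dots> = (\<Sum>q\<in>?Q. real (card {n \<in> {1..N}. q dvd n}) * (1 / real q))"
    by (simp flip: sum.inter_filter)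
  also have "\<dots> \<le> (\<Sum>q\<in>?Q. real N / (real q)\<^sup>2)"
  proof (rule sum_mono)
    fix q assume q: "q \<in> ?Q"
    have "{n \<in> {1..N}. q dvd n} \<subseteq> (\<lambda>k. q * k) ` {1..N div q}"
    proof
      fix n assume n: "n \<in> {n \<in> {1..N}. q dvd n}"
      then obtain k where k: "n = q * k" by auto
      with n q have "k \<in> {1..N div q}" by (auto simp: less_eq_div_iff_mult_less_eq mult.commute)
      with k show "n \<in> (\<lambda>k. q * k) ` {1..N div q}" by blast
    qed
    then have "card {n \<in> {1..N}. q dvd n} \<le> card ((\<lambda>k. q * k) ` {1..N div q})"
      by (intro card_mono) auto
    also have "\<dots> \<le> N div q" using card_image_le[of "{1..N div q}" "\<lambda>k. q * k"] by simp
    finally have "real (card {n \<in> {1..N}. q dvd n}) \<le> real N / real q"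
      using of_nat_div_le_of_nat[where 'a=real, of N q] by linarith
    from mult_right_mono[OF this, of "1 / real q"]
    show "real (card {n \<in> {1..N}. q dvd n}) * (1 / real q) \<le> real N / (real q)\<^sup>2"
      by (simp add: power2_eq_square)
  qed
  also have "\<dots> = real N * (\<Sum>q\<in>?Q. 1 / (real q)\<^sup>2)" by (simp add: sum_distrib_left)
  also have "(\<Sum>q\<in>?Q. 1 / (real q)\<^sup>2) \<le> (\<Sum>k\<in>{1..N}. 1 / (real (2 * k + 1))\<^sup>2)"
  proof -
    have "?Q \<subseteq> (\<lambda>k. 2 * k + 1) ` {1..N}"
    proof
      fix q assume q: "q \<in> ?Q"
      then obtain k where k: "q = 2 * k + 1" by (auto elim: oddE)
      moreover from k q have "k \<noteq> 0" by (auto intro: Nat.gr0I)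
      ultimately show "q \<in> (\<lambda>k. 2 * k + 1) ` {1..N}" using q by auto
    qed
    then have "(\<Sum>q\<in>?Q. 1 / (real q)\<^sup>2) \<le> (\<Sum>q\<in>(\<lambda>k. 2 * k + 1) ` {1..N}. 1 / (real q)\<^sup>2)"
      by (intro sum_mono2) auto
    then show ?thesis by (subst (asm) sum.reindex) (auto simp: inj_on_def)
  qed
  also have "\<dots> \<le> 1 / 4"
  proof -
    have "(\<Sum>k\<in>{1..N}. 1 / (real (2 * k + 1))\<^sup>2) \<le> 1 / 4 - 1 / (4 * (real N + 1))"
    proof (induction N)
      case (Suc N)
      have "1 / (real (2 * Suc N + 1))\<^sup>2 \<le> 1 / (4 * (real N + 1)) - 1 / (4 * (real (Suc N) + 1))"
      proof -
        have "1 / (4 * (real N + 1)) - 1 / (4 * (real (Suc N) + 1)) = 1 / (4 * (real N + 1) * (real N + 2))"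
          by (simp add: divide_simps)
        moreover have "4 * (real N + 1) * (real N + 2) \<le> (real (2 * Suc N + 1))\<^sup>2"
          by (simp add: power2_eq_square algebra_simps)
        ultimately show ?thesis by (simp add: frac_le del: of_nat_Suc)
      qed
      then show ?case using Suc by simp
    qed auto
    also have "\<dots> \<le> 1 / 4" by simp
    finally show ?thesis .
  qed
  finally show ?thesis by (simp add: mult_left_mono)
qed

text \<open>Markov's inequality: mean at most \<open>1/4\<close>, threshold \<open>3/8\<close>. Together with
  \<open>1/2\<close> for the prime \<open>2\<close> this keeps \<open>\<Sum>\<^sub>q 1/q\<close> at most \<open>7/8\<close>, below \<open>1\<close>.\<close>

lemma card_odd_prime_weight_le:
  "real N / 3 \<le> real (card {n \<in> {1..N}. odd_prime_weight n \<le> 3 / 8})"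
proof -
  let ?G = "{n \<in> {1..N}. odd_prime_weight n \<le> 3 / 8}" and ?B = "{n \<in> {1..N}. odd_prime_weight n > 3 / 8}"
  have nonneg: "odd_prime_weight n \<ge> 0" for n by (auto simp: odd_prime_weight_def intro: sum_nonneg)
  have "real (card ?B) * (3 / 8) \<le> (\<Sum>n\<in>?B. odd_prime_weight n)"
    by (intro sum_bounded_below) auto
  also have "\<dots> \<le> (\<Sum>n=1..N. odd_prime_weight n)" by (intro sum_mono2) (auto simp: nonneg)
  also have "\<dots> \<le> real N / 4" by (rule sum_odd_prime_weight_le)
  finally have "real (card ?B) \<le> 2 / 3 * real N" by simp
  moreover have "card ?G + card ?B = N"
  proof -
    have "card ?G + card ?B = card (?G \<union> ?B)" by (intro card_Un_disjoint[symmetric]) auto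
    also have "?G \<union> ?B = {1..N}" by auto
    finally show ?thesis by simp
  qed
  ultimately show ?thesis by linarith
qed

section \<open>Digits and multiplication on the circle\<close>

definition circle_vimage :: "nat \<Rightarrow> real set \<Rightarrow> real set" where
  "circle_vimage t A = {x \<in> {0..<1}. circle_mult t x \<in> A}"

lemma circle_mult_circle_mult: "circle_mult s (circle_mult t x) = circle_mult (s * t) x"
proof -
  have "real s * frac (real t * x) = real (s * t) * x - of_int (int s * \<lfloor>real t * x\<rfloor>)"
    by (simp add: frac_def algebra_simps)
  then have "frac (real s * frac (real t * x)) = frac (real (s * t) * x)"
    by (simp only: frac_def floor_diff_of_int of_int_diff)
  then show ?thesis by (simp only: circle_mult_def)
qed

lemma circle_mult_in_circle: "circle_mult t x \<in> {0..<1}"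
  by (simp add: circle_mult_def frac_lt_1)

lemma circle_vimage_circle_vimage: "circle_vimage s (circle_vimage t A) = circle_vimage (s * t) A"
  by (simp add: circle_vimage_def circle_mult_circle_mult circle_mult_in_circle mult.commute[of t s]
      del: atLeastLessThan_iff)

lemma circle_vimage_one: "A \<subseteq> {0..<1} \<Longrightarrow> circle_vimage 1 A = A"
proof -
  assume "A \<subseteq> {0..<1}"
  moreover have "circle_mult 1 x = x" if "x \<in> {0..<1}" for x
    using that frac_eq[of x] by (simp add: circle_mult_def)
  ultimately show ?thesis by (auto simp: circle_vimage_def simp del: atLeastLessThan_iff)
qed

lemma circle_vimage_circle: "circle_vimage t {0..<1} = {0..<1}"
  by (simp add: circle_vimage_def circle_mult_in_circle del: atLeastLessThan_iff)

lemma circle_mult_measurable: "circle_mult t \<in> measurable circle circle"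
  unfolding circle_mult_def by (rule measurable_circle_frac) simp

lemma circle_vimage_in_sets: "A \<in> sets circle \<Longrightarrow> circle_vimage t A \<in> sets circle"
proof -
  assume "A \<in> sets circle"
  from measurable_sets[OF circle_mult_measurable this, of t]
  have "circle_mult t -` A \<inter> {0..<1} \<in> sets circle" by simp
  moreover have "circle_vimage t A = circle_mult t -` A \<inter> {0..<1}"
    by (auto simp: circle_vimage_def)
  ultimately show "circle_vimage t A \<in> sets circle" by simp
qed

lemma floor_mult_less: "x \<in> {0..<1::real} \<Longrightarrow> q > 0 \<Longrightarrow> \<lfloor>real q * x\<rfloor> \<in> {0..<int q}"
  by (auto simp: floor_less_iff)

text \<open>On the set of points whose first base-\<open>q\<close> digit is \<open>i\<close>, multiplication by \<open>q\<close> is the affine bijection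
  \<open>x \<mapsto> q x - i\<close> onto the circle. Both invariance of the measure and independence of digits come from
  this.\<close>

lemma measure_circle_vimage_digit:
  assumes C: "C \<in> sets circle" and q: "q > 0" and i: "i \<in> {0..<int q}"
  shows "{x \<in> circle_vimage q C. \<lfloor>real q * x\<rfloor> = i} \<in> sets circle" (is "?D \<in> _")
    and "measure circle {x \<in> circle_vimage q C. \<lfloor>real q * x\<rfloor> = i} = measure circle C / real q"
proof -
  have CB [measurable]: "C \<in> sets borel" and C01: "C \<subseteq> {0..<1}" using C by (auto simp: sets_circle)
  have shift: "circle_mult q x = - real_of_int i + real q * x" if "\<lfloor>real q * x\<rfloor> = i" for x
    unfolding circle_mult_def frac_def that by linarith
  have D: "?D = (\<lambda>x. - real_of_int i + real q * x) -` C"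
  proof (rule Set.set_eqI)
    fix x
    show "x \<in> ?D \<longleftrightarrow> x \<in> (\<lambda>x. - real_of_int i + real q * x) -` C"
    proof
      assume "x \<in> ?D"
      then have "circle_mult q x \<in> C" "\<lfloor>real q * x\<rfloor> = i" by (simp_all add: circle_vimage_def)
      then show "x \<in> (\<lambda>x. - real_of_int i + real q * x) -` C"
        using shift[of x] by simp
    next
      assume x: "x \<in> (\<lambda>x. - real_of_int i + real q * x) -` C"
      then have "- real_of_int i + real q * x \<in> {0..<1}" using C01 by auto
      then have fl: "\<lfloor>real q * x\<rfloor> = i" by (auto simp: floor_eq_iff)
      then have "real_of_int i \<le> real q * x" "real q * x < real_of_int i + 1" by (simp_all add: floor_eq_iff)
      moreover have "0 \<le> real_of_int i" "real_of_int i + 1 \<le> real q" using i by auto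
      ultimately have "0 \<le> real q * x" "real q * x < real q * 1" by linarith+
      have "0 \<le> x"
        using \<open>0 \<le> real q * x\<close> q by (simp add: zero_le_mult_iff)
      moreover have "x < 1"
        using \<open>real q * x < real q * 1\<close> by (rule mult_left_less_imp_less) simp
      ultimately show "x \<in> ?D" using x fl shift[OF fl] by (simp add: circle_vimage_def)
    qed
  qed
  have D_borel: "?D \<in> sets borel" unfolding D
    using measurable_sets[of "\<lambda>x. - real_of_int i + real q * x" borel borel C] CB by simp
  then show sets: "?D \<in> sets circle" unfolding sets_circle by (auto simp: circle_vimage_def)
  have "emeasure lborel C = (\<integral>\<^sup>+ x. indicator C x \<partial>lborel)" by simp
  also have "\<dots> = ennreal \<bar>real q\<bar> * (\<integral>\<^sup>+ x. indicator C (- real_of_int i + real q * x) \<partial>lborel)"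
    using q by (intro nn_integral_real_affine) auto
  also have "(\<integral>\<^sup>+ x. indicator C (- real_of_int i + real q * x) \<partial>lborel) = (\<integral>\<^sup>+ x. indicator ?D x \<partial>lborel)"
    unfolding D by (intro nn_integral_cong) (auto simp: indicator_def)
  also have "\<dots> = emeasure lborel ?D" using D_borel by simp
  finally have "emeasure circle C = ennreal (real q) * emeasure circle ?D"
    using C sets by (simp add: emeasure_circle)
  then have "measure circle C = real q * measure circle ?D"
    unfolding measure_def by (simp add: enn2real_mult)
  then show "measure circle ?D = measure circle C / real q" using q by simp
qed

text \<open>The sets that depend only on the first digit \<open>\<lfloor>q x\<rfloor>\<close> in base \<open>q\<close>, that is, unions of intervals
  \<open>[i/q, (i+1)/q)\<close>.\<close>

definition first_digit_set :: "nat \<Rightarrow> real set \<Rightarrow> bool" where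
  "first_digit_set q A \<longleftrightarrow> A \<subseteq> {0..<1} \<and>
     (\<forall>x\<in>{0..<1}. \<forall>y\<in>{0..<1}. \<lfloor>real q * x\<rfloor> = \<lfloor>real q * y\<rfloor> \<longrightarrow> x \<in> A \<longrightarrow> y \<in> A)"

lemma measure_first_digit_set_Int_vimage:
  assumes A: "first_digit_set q A" and C: "C \<in> sets circle" and q: "q > 0"
  shows "A \<inter> circle_vimage q C \<in> sets circle"
    and "measure circle (A \<inter> circle_vimage q C)
      = real (card ((\<lambda>x. \<lfloor>real q * x\<rfloor>) ` A)) / real q * measure circle C"
proof -
  interpret prob_space circle by (rule prob_space_circle)
  define J where "J = (\<lambda>x. \<lfloor>real q * x\<rfloor>) ` A"
  have A01: "A \<subseteq> {0..<1}" using A by (simp add: first_digit_set_def)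
  have J: "J \<subseteq> {0..<int q}" unfolding J_def using floor_mult_less[OF subsetD[OF A01] q] by (rule image_subsetI)
  then have fin: "finite J" by (rule finite_subset) simp
  define D where "D i = {x \<in> circle_vimage q C. \<lfloor>real q * x\<rfloor> = i}" for i
  have eq: "A \<inter> circle_vimage q C = (\<Union>i\<in>J. D i)"
  proof
    show "(\<Union>i\<in>J. D i) \<subseteq> A \<inter> circle_vimage q C"
    proof
      fix y assume "y \<in> (\<Union>i\<in>J. D i)"
      then obtain x where x: "x \<in> A" "\<lfloor>real q * x\<rfloor> = \<lfloor>real q * y\<rfloor>" and y: "y \<in> circle_vimage q C"
        by (auto simp: D_def J_def)
      moreover have "x \<in> {0..<1}" "y \<in> {0..<1}" using x y A01 by (auto simp: circle_vimage_def)
      ultimately show "y \<in> A \<inter> circle_vimage q C" using A unfolding first_digit_set_def by blast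
    qed
  qed (auto simp: D_def J_def)
  have sets: "D i \<in> sets circle" and meas: "measure circle (D i) = measure circle C / real q"
    if "i \<in> J" for i
    unfolding D_def using measure_circle_vimage_digit[OF C q subsetD[OF J that]] by simp_all
  show "A \<inter> circle_vimage q C \<in> sets circle" unfolding eq using fin sets by auto
  have "measure circle (\<Union>i\<in>J. D i) = (\<Sum>i\<in>J. measure circle (D i))"
    by (rule finite_measure_finite_Union[OF fin]) (use sets in \<open>auto simp: disjoint_family_on_def D_def\<close>)
  also have "\<dots> = real (card J) / real q * measure circle C"
    using meas by simp
  finally show "measure circle (A \<inter> circle_vimage q C)
      = real (card ((\<lambda>x. \<lfloor>real q * x\<rfloor>) ` A)) / real q * measure circle C"
    unfolding eq J_def[symmetric] .
qed

lemma first_digit_set_in_sets: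
  assumes "first_digit_set q A" "q > 0"
  shows "A \<in> sets circle"
proof -
  have "A \<inter> {0..<1} = A" using assms(1) by (auto simp: first_digit_set_def)
  then show ?thesis
    using measure_first_digit_set_Int_vimage(1)[OF assms(1) _ assms(2), of "{0..<1}"]
    by (simp add: sets_circle circle_vimage_circle)
qed

text \<open>The set \<open>circle_vimage q C\<close> is described by the digits after the first one.\<close>

lemma first_digit_independent:
  assumes A: "first_digit_set q A" and C: "C \<in> sets circle" and q: "q > 0"
  shows "measure circle (A \<inter> circle_vimage q C) = measure circle A * measure circle C"
proof -
  interpret prob_space circle by (rule prob_space_circle)
  have "A \<inter> {0..<1} = A" using A by (auto simp: first_digit_set_def)
  moreover have "measure circle {0..<1} = 1" using prob_space by simp
  ultimately have "measure circle A = real (card ((\<lambda>x. \<lfloor>real q * x\<rfloor>) ` A)) / real q"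
    using measure_first_digit_set_Int_vimage(2)[OF A _ q, of "{0..<1}"]
    by (simp add: sets_circle circle_vimage_circle)
  then show ?thesis using measure_first_digit_set_Int_vimage(2)[OF A C q] by simp
qed

lemma measure_circle_vimage:
  assumes "C \<in> sets circle" "q > 0"
  shows "measure circle (circle_vimage q C) = measure circle C"
proof -
  interpret prob_space circle by (rule prob_space_circle)
  have "first_digit_set q {0..<1}" by (simp add: first_digit_set_def)
  moreover have "{0..<1} \<inter> circle_vimage q C = circle_vimage q C" by (auto simp: circle_vimage_def)
  ultimately show ?thesis
    using first_digit_independent[OF _ assms, of "{0..<1}"] prob_space by simp
qed

text \<open>The first base-\<open>q\<close> digit of \<open>t x\<close> is \<open>\<lfloor>q t x\<rfloor>\<close> reduced modulo \<open>q\<close>.\<close>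

lemma first_digit_set_vimage:
  assumes A: "first_digit_set q A" and "q > 0" "t > 0"
  shows "first_digit_set (q * t) (circle_vimage t A)"
  unfolding first_digit_set_def
proof (intro conjI ballI impI)
  fix x y :: real
  assume xy: "x \<in> {0..<1}" "y \<in> {0..<1}" "\<lfloor>real (q * t) * x\<rfloor> = \<lfloor>real (q * t) * y\<rfloor>" "x \<in> circle_vimage t A"
  have fl: "\<lfloor>real q * circle_mult t z\<rfloor> = \<lfloor>real (q * t) * z\<rfloor> - int q * (\<lfloor>real (q * t) * z\<rfloor> div int q)" for z
  proof -
    have "\<lfloor>real t * z\<rfloor> = \<lfloor>real (q * t) * z\<rfloor> div int q"
      using floor_divide_real_eq_div[of "int q" "real (q * t) * z"] \<open>q > 0\<close> by simp
    moreover have "real q * circle_mult t z = real (q * t) * z - of_int (int q * \<lfloor>real t * z\<rfloor>)"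
      by (simp add: circle_mult_def frac_def algebra_simps)
    ultimately show ?thesis by (simp only: floor_diff_of_int)
  qed
  then have "\<lfloor>real q * circle_mult t x\<rfloor> = \<lfloor>real q * circle_mult t y\<rfloor>" using xy(3) by simp
  moreover have "circle_mult t x \<in> A" using xy(4) by (simp add: circle_vimage_def)
  ultimately have "circle_mult t y \<in> A"
    using A circle_mult_in_circle[of t] unfolding first_digit_set_def by blast
  then show "y \<in> circle_vimage t A" using xy(2) by (simp add: circle_vimage_def)
qed (auto simp: circle_vimage_def)

lemma first_digit_set_dvd:
  assumes A: "first_digit_set q A" and "q dvd q'" "q > 0" "q' > 0"
  shows "first_digit_set q' A"
proof -
  obtain c where c: "q' = c * q" using assms(2) by (metis dvdE mult.commute)
  have "\<lfloor>real q * z\<rfloor> = \<lfloor>real q' * z\<rfloor> div int c" for z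
    using floor_divide_real_eq_div[of "int c" "real q' * z"] assms(4) by (simp add: c)
  then have "\<lfloor>real q * x\<rfloor> = \<lfloor>real q * y\<rfloor>" if "\<lfloor>real q' * x\<rfloor> = \<lfloor>real q' * y\<rfloor>" for x y
    by (simp only: that)
  then show ?thesis using A unfolding first_digit_set_def by blast
qed

lemma first_digit_set_UN:
  "(\<And>i. i \<in> I \<Longrightarrow> first_digit_set q (A i)) \<Longrightarrow> first_digit_set q (\<Union>i\<in>I. A i)"
  unfolding first_digit_set_def by blast

lemma first_digit_set_compl:
  assumes "first_digit_set q A"
  shows "first_digit_set q ({0..<1} - A)"
  unfolding first_digit_set_def
proof (intro conjI ballI impI)
  fix x y :: real
  assume "x \<in> {0..<1}" "y \<in> {0..<1}" "\<lfloor>real q * x\<rfloor> = \<lfloor>real q * y\<rfloor>" "x \<in> {0..<1} - A"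
  moreover from this have "y \<notin> A" using assms unfolding first_digit_set_def by (metis DiffD2)
  ultimately show "y \<in> {0..<1} - A" by blast
qed auto

text \<open>The sets \<open>circle_vimage (q ^ i) G\<close> put the same condition on the \<open>i\<close>-th digit for different \<open>i\<close>, so
  avoiding \<open>r\<close> of them has the probability of \<open>r\<close> independent failures.\<close>

lemma measure_avoid_digits:
  assumes G: "first_digit_set q G" and q: "q > 0"
  shows "{0..<1} - (\<Union>i<r. circle_vimage (q ^ i) G) \<in> sets circle \<and>
    measure circle ({0..<1} - (\<Union>i<r. circle_vimage (q ^ i) G)) = (1 - measure circle G) ^ r"
proof (induction r)
  interpret prob_space circle by (rule prob_space_circle)
  case 0
  then show ?case using prob_space by (simp add: sets_circle)
next
  interpret prob_space circle by (rule prob_space_circle)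
  case (Suc r)
  let ?C = "{0..<1} - (\<Union>i<r. circle_vimage (q ^ i) G)"
  have G01: "G \<subseteq> {0..<1}" using G by (simp add: first_digit_set_def)
  \<comment> \<open>Split off the condition on the first digit; the others are conditions on the digits of \<open>q x\<close>.\<close>
  have shift: "(\<Union>i<Suc r. circle_vimage (q ^ i) G) = G \<union> (\<Union>i<r. circle_vimage q (circle_vimage (q ^ i) G))"
    unfolding lessThan_Suc_eq_insert_0
    using circle_vimage_one[OF G01] by (simp add: circle_vimage_circle_vimage image_comp)
  have eq: "{0..<1} - (\<Union>i<Suc r. circle_vimage (q ^ i) G) = ({0..<1} - G) \<inter> circle_vimage q ?C"
    unfolding shift using circle_mult_in_circle[of q] by (auto simp: circle_vimage_def simp del: atLeastLessThan_iff)
  have "measure circle ({0..<1} - G) = 1 - measure circle G"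
    using prob_compl[OF first_digit_set_in_sets[OF G q]] by simp
  then show ?case
    unfolding eq
    using measure_first_digit_set_Int_vimage(1)[OF first_digit_set_compl[OF G] _ q, of ?C]
      first_digit_independent[OF first_digit_set_compl[OF G] _ q, of ?C] Suc by simp
qed

text \<open>The interval starts at \<open>1/(2W)\<close> and has length \<open>1/(4W\<^sup>2)\<close>. If \<open>m x\<close> and \<open>m' x\<close> both lay in it,
  then multiplying the first by \<open>m'\<close> and the second by \<open>m\<close> would show that \<open>(m' - m)/(2W)\<close> lies
  within \<open>1/(4W)\<close> of an integer; but it is between \<open>1/(2W)\<close> and \<open>1/2 - 1/(2W)\<close>.\<close>

lemma circle_vimage_interval_disjoint:
  fixes W m m' :: nat
  defines "B \<equiv> {2 * real W / real (4 * W\<^sup>2)..<(2 * real W + 1) / real (4 * W\<^sup>2)}"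
  assumes m: "0 < m" "m < m'" "m' < W"
  shows "circle_vimage m B \<inter> circle_vimage m' B = {}"
proof (rule ccontr)
  assume "\<not> ?thesis"
  then obtain x where x: "circle_mult m x \<in> B" "circle_mult m' x \<in> B"
    by (auto simp: circle_vimage_def)
  define Q where "Q = 4 * (real W)\<^sup>2"
  have W: "real W > 0" and Q: "Q > 0" using m by (auto simp: Q_def)
  define u v where "u = Q * circle_mult m x - 2 * real W" and "v = Q * circle_mult m' x - 2 * real W"
  have uv: "0 \<le> u" "u < 1" "0 \<le> v" "v < 1"
    using x Q by (auto simp: B_def u_def v_def Q_def[symmetric] divide_le_eq le_divide_eq less_divide_eq divide_less_eq mult.commute)
  define z where "z = int m * \<lfloor>real m' * x\<rfloor> - int m' * \<lfloor>real m * x\<rfloor>"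
  have "real m' * (Q * circle_mult m x) - real m * (Q * circle_mult m' x) = Q * of_int z"
    by (simp add: circle_mult_def frac_def z_def algebra_simps)
  then have z: "Q * of_int z = 2 * real W * (real m' - real m) + real m' * u - real m * v"
    by (simp add: u_def v_def algebra_simps)
  have "real m * v \<le> real m * 1" "real m' * u \<le> real m' * 1" "0 \<le> real m' * u" "0 \<le> real m * v"
    using uv mult_left_mono[of v 1 "real m"] mult_left_mono[of u 1 "real m'"] by auto
  moreover have "2 * real W * 1 \<le> 2 * real W * (real m' - real m)"
    using m by (intro mult_left_mono) auto
  moreover have "2 * real W * (real m' - real m) \<le> 2 * real W * (real W - 1)"
    using m by (intro mult_left_mono) auto
  moreover have "real m' < real W" "real m < real W" using m by auto
  moreover have "2 * real W * (real W - 1) = 2 * (real W * real W) - 2 * real W" "Q = 4 * (real W * real W)"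
    by (simp_all add: Q_def power2_eq_square algebra_simps)
  moreover have "0 < real W * real W" using W by simp
  ultimately have "0 < Q * of_int z" "Q * of_int z < Q * 1"
    unfolding z by linarith+
  then have "0 < z" "z < 1" using Q by (auto simp: zero_less_mult_iff)
  then show False by simp
qed

lemma tower_base:
  assumes W: "W > 1"
  defines "B \<equiv> {2 * real W / real (4 * W\<^sup>2)..<(2 * real W + 1) / real (4 * W\<^sup>2)}"
  shows "first_digit_set (4 * W\<^sup>2) B" "measure circle B > 0"
proof -
  define Q where "Q = 4 * W\<^sup>2"
  have Q: "real Q > 0" using W by (simp add: Q_def)
  have QW: "2 * real W + 1 \<le> real Q"
  proof -
    have "2 * W + 1 \<le> Q" using W mult_le_mono1[of 2 W W] unfolding Q_def power2_eq_square by linarith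
    then have "real (2 * W + 1) \<le> real Q" by (simp only: of_nat_le_iff)
    then show ?thesis by simp
  qed
  have B01: "B \<subseteq> {0..<1}"
  proof
    fix x assume "x \<in> B"
    moreover have "(2 * real W + 1) / real Q \<le> 1" using QW Q by simp
    moreover have "0 \<le> 2 * real W / real Q" by simp
    ultimately show "x \<in> {0..<1}"
      unfolding B_def Q_def[symmetric] atLeastLessThan_iff by linarith
  qed
  have mem: "x \<in> B \<longleftrightarrow> \<lfloor>real Q * x\<rfloor> = 2 * int W" for x
    unfolding B_def Q_def[symmetric] using Q
    by (simp add: floor_eq_iff pos_divide_le_eq pos_less_divide_eq mult.commute)
  show "first_digit_set (4 * W\<^sup>2) B"
    unfolding Q_def[symmetric] first_digit_set_def using B01 mem by simp
  have "B \<in> sets circle" using B01 by (simp add: sets_circle B_def)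
  then have "emeasure circle B = emeasure lborel B" by (rule emeasure_circle)
  then have "measure circle B = measure lborel B" by (simp add: measure_def)
  also have "\<dots> = (2 * real W + 1) / real Q - 2 * real W / real Q"
    unfolding B_def Q_def[symmetric] using Q by (simp add: divide_right_mono)
  finally show "measure circle B > 0" using Q by (simp flip: diff_divide_distrib)
qed

section \<open>Sweeping by multiplicatively independent numbers\<close>

definition has_new_primes :: "(nat \<Rightarrow> nat) \<Rightarrow> nat set \<Rightarrow> bool" where
  "has_new_primes lam D \<longleftrightarrow>
     (\<forall>n\<in>D. lam n > 0 \<and> (\<exists>p. prime p \<and> p dvd lam n \<and> (\<forall>m\<in>D. m < n \<longrightarrow> \<not> p dvd lam m)))"

text \<open>The new prime of the largest index in \<open>I\<close> divides no other factor, so its multiplicity reads off the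
  exponent there.\<close>

lemma prod_powers_inject:
  fixes lam :: "nat \<Rightarrow> nat"
  assumes new: "has_new_primes lam D"
  shows "finite I \<Longrightarrow> I \<subseteq> D \<Longrightarrow> (\<Prod>n\<in>I. lam n ^ k n) = (\<Prod>n\<in>I. lam n ^ k' n) \<Longrightarrow> \<forall>n\<in>I. k n = k' n"
proof (induction I rule: finite_linorder_max_induct)
  case (insert b A)
  have b: "b \<in> D" "A \<subseteq> D" using insert.prems by auto
  obtain p where p: "prime p" "p dvd lam b" "\<And>m. m \<in> D \<Longrightarrow> m < b \<Longrightarrow> \<not> p dvd lam m"
    using new b unfolding has_new_primes_def by meson
  have pos: "lam n > 0" if "n \<in> D" for n using new that by (auto simp: has_new_primes_def)
  have notin: "b \<notin> A" using insert.hyps by auto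
  have mult: "multiplicity p (\<Prod>n\<in>insert b A. lam n ^ e n) = e b * multiplicity p (lam b)" for e
  proof -
    have "\<not> p dvd (\<Prod>n\<in>A. lam n ^ e n)"
    proof
      assume "p dvd (\<Prod>n\<in>A. lam n ^ e n)"
      then obtain n where n: "n \<in> A" "p dvd lam n ^ e n"
        using p(1) insert.hyps(1) by (auto simp: prime_dvd_prod_iff)
      then have "p dvd lam n" using p(1) prime_dvd_power by blast
      then show False using p(3)[of n] n insert.hyps(2) b(2) by auto
    qed
    moreover have "(\<Prod>n\<in>A. lam n ^ e n) \<noteq> 0" using pos b(2) insert.hyps(1) by auto
    moreover have "lam b \<noteq> 0" using pos b by simp
    ultimately show ?thesis
      using p(1) notin insert.hyps(1)
      by (simp add: prime_elem_multiplicity_mult_distrib prime_elem_multiplicity_power_distrib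
          not_dvd_imp_multiplicity_0)
  qed
  have "multiplicity p (lam b) > 0"
    using p pos[OF b(1)] by (auto simp: prime_multiplicity_gt_zero_iff)
  then have eq: "k b = k' b" using mult[of k] mult[of k'] insert.prems(2) by simp
  then have "(\<Prod>n\<in>A. lam n ^ k n) = (\<Prod>n\<in>A. lam n ^ k' n)"
    using insert.prems(2) notin insert.hyps(1) pos[OF b(1)] by simp
  then show ?case using insert.IH b(2) eq by simp
qed simp

text \<open>By Bernoulli's inequality, a box whose side exceeds twice its dimension loses at most half of its points
  when one layer is removed in every direction.\<close>

lemma card_inner_box:
  assumes "finite (I :: nat set)" "L = 2 * card I + 1"
  shows "L ^ card I \<le> 2 * (L - 1) ^ card I"
proof -
  let ?d = "card I"
  have L: "real L > 0" using assms by simp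
  have "1 / 2 \<le> 1 + real ?d * (- 1 / real L)" using assms by (simp add: field_simps)
  also have "\<dots> \<le> (1 + (- 1 / real L)) ^ ?d"
    using assms by (intro Bernoulli_inequality) simp
  also have "1 + (- 1 / real L) = real (L - 1) / real L" using assms L by (simp add: field_simps)
  finally have "real (L ^ ?d) \<le> real (2 * (L - 1) ^ ?d)"
    using L by (simp add: power_divide field_simps)
  then show ?thesis by (simp only: of_nat_le_iff)
qed

lemma colour_class_pigeonhole:
  fixes \<phi> :: "'a \<Rightarrow> nat"
  assumes "finite X" "K > 0"
  obtains r where "r < K" "K * card {x \<in> X. \<phi> x mod K = r} \<le> card X"
proof -
  have "\<exists>r<K. K * card {x \<in> X. \<phi> x mod K = r} \<le> card X"
  proof (rule ccontr)
    assume "\<not> ?thesis"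
    then have big: "\<And>r. r \<in> {..<K} \<Longrightarrow> card X < K * card {x \<in> X. \<phi> x mod K = r}" by force
    have "card X = (\<Sum>r<K. card {x \<in> X. \<phi> x mod K = r})"
      using sum.group[of X "{..<K}" "\<lambda>x. \<phi> x mod K" "\<lambda>_. 1::nat"] assms by (auto simp: image_subset_iff)
    then have "K * card X = (\<Sum>r<K. K * card {x \<in> X. \<phi> x mod K = r})" by (simp add: sum_distrib_left)
    also have "\<dots> > (\<Sum>r<K. card X)" using big assms by (intro sum_strict_mono) auto
    finally show False by simp
  qed
  then show ?thesis using that by blast
qed

text \<open>The finite model of the failing maximal inequality: from every \<open>m \<in> P\<close>, a proportion \<open>\<delta>/2\<close> of the
  divisions by \<open>\<lambda>\<^sub>n\<close>, \<open>n \<le> N\<close>, leads into \<open>S\<close>, while \<open>S\<close> is smaller than \<open>P\<close> by a factor of about \<open>K/2\<close>.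
  A monomial has as its colour the sum of its exponents weighted by block numbers, and \<open>S\<close> is a colour
  class modulo \<open>K\<close> of at most average size. Dividing by \<open>\<lambda>\<^sub>n\<close> with \<open>n\<close> in block \<open>j\<close> lowers the colour by \<open>j\<close>, so
  exactly one block \<open>j < K\<close> moves \<open>m\<close> into \<open>S\<close>. The bound \<open>N0\<close> makes the sweeping times arbitrarily late.\<close>

lemma multiplicative_sweeping:
  fixes lam :: "nat \<Rightarrow> nat" and \<delta> :: real
  assumes new: "has_new_primes lam D"
    and \<delta>: "\<delta> > 0" and dense: "\<And>N. N \<ge> N1 \<Longrightarrow> \<delta> * real N \<le> real (card (D \<inter> {1..N}))"
    and K: "K > 0"
  obtains P S where "finite P" "finite S" "P \<noteq> {}" "0 \<notin> P" "0 \<notin> S" "K * card S \<le> 2 * card P"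
    "\<And>m. m \<in> P \<Longrightarrow> \<exists>N\<ge>N0. N > 0 \<and> \<delta> / 2 * real N \<le> real (card {n \<in> {1..N}. lam n dvd m \<and> m div lam n \<in> S})"
proof -
  \<comment> \<open>Blocks end at \<open>V, V R, V R\<^sup>2, \<dots>\<close>; since \<open>R \<ge> 2/\<delta>\<close>, all indices before a block are at most half of those in \<open>D\<close> up to its end.\<close>
  define R where "R = nat \<lceil>2 / \<delta>\<rceil>"
  define V where "V = max 1 (max N0 N1)"
  define T where "T j = V * R ^ j" for j
  have R2: "2 / \<delta> \<le> real R" unfolding R_def by linarith
  then have R: "R > 0" "2 \<le> \<delta> * real R" using \<delta> by (auto simp: field_simps intro!: Nat.gr0I)
  have T_ge: "T j \<ge> V" for j using R by (simp add: T_def)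
  have T_mono: "i \<le> j \<Longrightarrow> T i \<le> T j" for i j using R by (simp add: T_def power_increasing)
  have V: "V \<ge> 1" "V \<ge> N0" "V \<ge> N1" by (auto simp: V_def)
  define block where "block j = D \<inter> {T j<..T (Suc j)}" for j
  have card_block: "\<delta> / 2 * real (T (Suc j)) \<le> real (card (block j))" for j
  proof -
    have "D \<inter> {1..T (Suc j)} \<subseteq> block j \<union> {1..T j}" by (auto simp: block_def)
    then have "card (D \<inter> {1..T (Suc j)}) \<le> card (block j \<union> {1..T j})"
      by (intro card_mono) (auto simp: block_def)
    also have "\<dots> \<le> card (block j) + T j" using card_Un_le[of "block j" "{1..T j}"] by simp
    finally have "\<delta> * real (T (Suc j)) \<le> real (card (block j)) + real (T j)"
      using dense[of "T (Suc j)"] T_ge[of "Suc j"] V by linarith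
    moreover have "real (T j) * 2 \<le> real (T j) * (\<delta> * real R)" using R by (intro mult_left_mono) auto
    then have "real (T j) \<le> \<delta> / 2 * real (T (Suc j))" by (simp add: T_def mult_ac)
    ultimately show ?thesis by linarith
  qed
  define colour where "colour n = (LEAST j. n \<le> T (Suc j))" for n
  have colour: "colour n = j" if "n \<in> block j" for n j
    unfolding colour_def
  proof (rule Least_equality)
    fix i assume "n \<le> T (Suc i)"
    then show "j \<le> i" using that T_mono[of "Suc i" j] by (cases "Suc i \<le> j") (auto simp: block_def)
  qed (use that in \<open>auto simp: block_def\<close>)
  define I where "I = (\<Union>j<K. block j)"
  have I: "finite I" "I \<subseteq> D" by (auto simp: I_def block_def)
  define L where "L = 2 * card I + 1"
  define \<phi> where "\<phi> k = (\<Sum>n\<in>I. colour n * k n)" for k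
  define monomial where "monomial k = (\<Prod>n\<in>I. lam n ^ k n)" for k
  define box where "box = PiE I (\<lambda>_. {0..<L})"
  define inner where "inner = PiE I (\<lambda>_. {1..<L})"
  have inner_box: "inner \<subseteq> box" unfolding inner_def box_def by (intro PiE_mono) auto
  have fin: "finite box" unfolding box_def using I by (intro finite_PiE) auto
  have pos: "lam n > 0" if "n \<in> D" for n using new that by (auto simp: has_new_primes_def)
  have monomial_pos: "monomial k > 0" for k unfolding monomial_def by (rule prod_pos) (use pos I in auto)
  have inj: "inj_on monomial box"
  proof (rule inj_onI)
    fix k k' assume k: "k \<in> box" "k' \<in> box" "monomial k = monomial k'"
    then have "\<forall>n\<in>I. k n = k' n" using prod_powers_inject[OF new I] by (simp add: monomial_def)
    then show "k = k'" using k by (auto simp: box_def intro: PiE_ext)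
  qed
  obtain r where r: "r < K" "K * card {k \<in> box. \<phi> k mod K = r} \<le> card box"
    using colour_class_pigeonhole[OF fin K] .
  define S where "S = monomial ` {k \<in> box. \<phi> k mod K = r}"
  define P where "P = monomial ` inner"
  show ?thesis
  proof (rule that[of P S])
    show "finite P" "finite S" using fin inner_box by (auto simp: P_def S_def intro: finite_subset)
    show "P \<noteq> {}"
    proof (cases "I = {}")
      case False
      then have "card I > 0" using I by (simp add: card_gt_0_iff)
      then have "{1..<L} \<noteq> {}" by (simp add: L_def)
      then show ?thesis by (simp add: P_def inner_def PiE_eq_empty_iff)
    qed (simp add: P_def inner_def)
    show "0 \<notin> P" "0 \<notin> S" using monomial_pos by (auto simp: P_def S_def) (metis less_irrefl)+
    have "K * card S \<le> K * card {k \<in> box. \<phi> k mod K = r}"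
      unfolding S_def using fin by (intro mult_le_mono card_image_le) auto
    also have "\<dots> \<le> L ^ card I" using r(2) I by (simp add: box_def card_PiE)
    also have "\<dots> \<le> 2 * (L - 1) ^ card I" by (rule card_inner_box[OF I(1) L_def])
    also have "(L - 1) ^ card I = card inner" using I by (simp add: inner_def card_PiE)
    also have "card inner = card P"
      unfolding P_def using inj_on_subset[OF inj inner_box] by (simp add: card_image)
    finally show "K * card S \<le> 2 * card P" .
  next
    fix m assume "m \<in> P"
    then obtain k where k: "k \<in> inner" "m = monomial k" by (auto simp: P_def)
    \<comment> \<open>The block whose number is the colour of \<open>m\<close> minus that of \<open>S\<close>.\<close>
    define j where "j = nat ((int (\<phi> k) - int r) mod int K)"
    have j: "j < K" "int j = (int (\<phi> k) - int r) mod int K"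
      using K by (auto simp: j_def nat_less_iff)
    have hit: "n \<in> {n \<in> {1..T (Suc j)}. lam n dvd m \<and> m div lam n \<in> S}" if n: "n \<in> block j" for n
    proof -
      have nI: "n \<in> I" using n j by (auto simp: I_def)
      have kn: "k n \<ge> 1" "k n < L" using k nI by (auto simp: inner_def PiE_iff)
      define k' where "k' = k(n := k n - 1)"
      have k': "k' \<in> box" using k inner_box kn nI by (auto simp: box_def k'_def PiE_iff extensional_def)
      have "\<phi> k = colour n * k n + (\<Sum>i\<in>I - {n}. colour i * k i)"
        "\<phi> k' = colour n * k' n + (\<Sum>i\<in>I - {n}. colour i * k' i)"
        unfolding \<phi>_def using I nI by (auto intro: sum.remove)
      moreover have "(\<Sum>i\<in>I - {n}. colour i * k' i) = (\<Sum>i\<in>I - {n}. colour i * k i)"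
        by (intro sum.cong) (auto simp: k'_def)
      moreover have "colour n * k n = colour n * k' n + colour n"
        using kn by (cases "k n") (auto simp: k'_def)
      ultimately have "\<phi> k = \<phi> k' + j" using colour[OF n] by simp
      then have "int (\<phi> k') mod int K = (int (\<phi> k) - int j) mod int K" by simp
      also have "\<dots> = int r mod int K" unfolding j(2) by (simp add: mod_diff_right_eq)
      finally have "\<phi> k' mod K = r" using r(1) by (simp flip: of_nat_mod)
      then have S: "monomial k' \<in> S" using k' by (auto simp: S_def)
      have "monomial k = lam n ^ k n * (\<Prod>i\<in>I - {n}. lam i ^ k i)"
        "monomial k' = lam n ^ k' n * (\<Prod>i\<in>I - {n}. lam i ^ k' i)"
        unfolding monomial_def using I nI by (auto intro: prod.remove)
      moreover have "(\<Prod>i\<in>I - {n}. lam i ^ k' i) = (\<Prod>i\<in>I - {n}. lam i ^ k i)"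
        by (intro prod.cong) (auto simp: k'_def)
      moreover have "lam n ^ k n = lam n * lam n ^ k' n"
        using kn by (cases "k n") (auto simp: k'_def)
      ultimately have "m = lam n * monomial k'" using k by simp
      then show ?thesis using S n pos[of n] by (auto simp: block_def)
    qed
    have "card (block j) \<le> card {n \<in> {1..T (Suc j)}. lam n dvd m \<and> m div lam n \<in> S}"
      using hit by (intro card_mono) auto
    then have "\<delta> / 2 * real (T (Suc j)) \<le> real (card {n \<in> {1..T (Suc j)}. lam n dvd m \<and> m div lam n \<in> S})"
      using card_block[of j] by linarith
    moreover have "T (Suc j) \<ge> N0" "T (Suc j) > 0" using T_ge[of "Suc j"] V by auto
    ultimately show "\<exists>N\<ge>N0. N > 0 \<and> \<delta> / 2 * real N \<le> real (card {n \<in> {1..N}. lam n dvd m \<and> m div lam n \<in> S})"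
      by blast
  qed
qed

section \<open>Small sets visited from half of the circle\<close>

definition visits :: "(nat \<Rightarrow> nat) \<Rightarrow> real set \<Rightarrow> nat \<Rightarrow> real \<Rightarrow> nat" where
  "visits lam E N x = card {n \<in> {1..N}. circle_mult (lam n) x \<in> E}"

lemma visits_mono: "E \<subseteq> E' \<Longrightarrow> visits lam E N x \<le> visits lam E' N x"
  unfolding visits_def by (intro card_mono) auto

text \<open>Multiplications commute, so relations between visits and starting points pull back along each of
  them.\<close>

lemma visits_circle_vimage:
  "visits lam (circle_vimage t E) N x = visits lam E N (circle_mult t x)"
  unfolding visits_def circle_vimage_def
  by (simp add: circle_mult_circle_mult circle_mult_in_circle mult.commute[of t] del: atLeastLessThan_iff)

text \<open>A Rokhlin tower for the commuting maps \<open>x \<mapsto> m x\<close> with exactly disjoint levels. Its total measure may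
  be tiny, which is harmless since the tower is spread over the circle afterwards.\<close>

lemma multiplicative_tower:
  assumes M: "finite M" "0 \<notin> M"
  obtains B q where "B \<in> sets circle" "measure circle B > 0" "q > 0"
    "disjoint_family_on (\<lambda>m. circle_vimage m B) M"
    "\<And>m. m \<in> M \<Longrightarrow> first_digit_set q (circle_vimage m B)"
proof -
  \<comment> \<open>Inserting \<open>1\<close> covers the empty \<open>M\<close> and ensures \<open>W > 1\<close>.\<close>
  define W where "W = Suc (Max (insert 1 M))"
  have "1 \<le> Max (insert 1 M)" using M by (intro Max_ge) auto
  then have W: "W > 1" unfolding W_def by linarith
  have less: "m < W" if "m \<in> M" for m using M that by (simp add: W_def less_Suc_eq_le)
  define B where "B = {2 * real W / real (4 * W\<^sup>2)..<(2 * real W + 1) / real (4 * W\<^sup>2)}"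
  have B: "first_digit_set (4 * W\<^sup>2) B" "measure circle B > 0"
    using tower_base[OF W] by (simp_all only: B_def)
  have pos: "m > 0" if "m \<in> M" for m using M that by (cases m) auto
  have W2: "4 * W\<^sup>2 > 0" using W by simp
  \<comment> \<open>The level of \<open>m\<close> depends on the first digit in base \<open>4 W\<^sup>2 m\<close>; a common multiple serves all levels.\<close>
  define q where "q = 4 * W\<^sup>2 * \<Prod>M"
  have q: "q > 0" using W2 pos by (auto simp: q_def intro!: prod_pos)
  show ?thesis
  proof (rule that[OF _ B(2) q])
    show "B \<in> sets circle" using first_digit_set_in_sets[OF B(1) W2] .
    show "disjoint_family_on (\<lambda>m. circle_vimage m B) M"
      unfolding disjoint_family_on_def
    proof (intro ballI impI)
      fix m m' assume m: "m \<in> M" "m' \<in> M" "m \<noteq> m'"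
      then consider "m < m'" | "m' < m" by linarith
      then show "circle_vimage m B \<inter> circle_vimage m' B = {}"
        using circle_vimage_interval_disjoint[of m m' W] circle_vimage_interval_disjoint[of m' m W]
          pos[OF m(1)] pos[OF m(2)] less[OF m(1)] less[OF m(2)]
        by cases (auto simp: B_def[symmetric] Int_commute simp del: of_nat_mult of_nat_power)
    qed
    fix m assume m: "m \<in> M"
    show "first_digit_set q (circle_vimage m B)"
    proof (rule first_digit_set_dvd[OF first_digit_set_vimage[OF B(1) W2 pos[OF m]] _ _ q])
      show "4 * W\<^sup>2 * m dvd q" unfolding q_def using M m by (intro mult_dvd_mono dvd_prodI) auto
      show "4 * W\<^sup>2 * m > 0" using W2 pos[OF m] by simp
    qed
  qed
qed

text \<open>If \<open>x\<close> is in the level of \<open>m\<close> and \<open>\<lambda>\<^sub>n\<close> divides \<open>m\<close>, then \<open>\<lambda>\<^sub>n x\<close> is in the level of \<open>m / \<lambda>\<^sub>n\<close>, so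
  the model is copied by taking for \<open>E\<close> and \<open>G\<close> the levels in \<open>S\<close> and in \<open>P\<close>.\<close>

lemma sweeping_sets:
  fixes lam :: "nat \<Rightarrow> nat" and \<delta> :: real
  assumes new: "has_new_primes lam D"
    and \<delta>: "\<delta> > 0" and dense: "\<And>N. N \<ge> N1 \<Longrightarrow> \<delta> * real N \<le> real (card (D \<inter> {1..N}))"
    and K: "K > 0"
  obtains E G q where "q > 0" "E \<in> sets circle" "first_digit_set q G" "measure circle G > 0"
    "real K * measure circle E \<le> 2 * measure circle G"
    "\<And>x. x \<in> G \<Longrightarrow> \<exists>N\<ge>N0. N > 0 \<and> \<delta> / 2 * real N \<le> real (visits lam E N x)"
proof -
  interpret prob_space circle by (rule prob_space_circle)
  obtain P S where PS: "finite P" "finite S" "P \<noteq> {}" "0 \<notin> P" "0 \<notin> S" "K * card S \<le> 2 * card P"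
    and hit: "\<And>m. m \<in> P \<Longrightarrow> \<exists>N\<ge>N0. N > 0 \<and>
      \<delta> / 2 * real N \<le> real (card {n \<in> {1..N}. lam n dvd m \<and> m div lam n \<in> S})"
    by (rule multiplicative_sweeping[OF new \<delta> dense K, where ?N0.0 = N0]) (assumption | rule that)+
  obtain B q where B: "B \<in> sets circle" "measure circle B > 0" and q: "q > 0"
    and disj: "disjoint_family_on (\<lambda>m. circle_vimage m B) (P \<union> S)"
    and digit: "\<And>m. m \<in> P \<union> S \<Longrightarrow> first_digit_set q (circle_vimage m B)"
    using multiplicative_tower[of "P \<union> S"] PS by auto
  define E where "E = (\<Union>m\<in>S. circle_vimage m B)"
  define G where "G = (\<Union>m\<in>P. circle_vimage m B)"
  have level: "measure circle (\<Union>m\<in>M. circle_vimage m B) = real (card M) * measure circle B"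
    if "M \<subseteq> P \<union> S" for M
  proof -
    have "finite M" using PS that by (auto intro: finite_subset)
    then have "measure circle (\<Union>m\<in>M. circle_vimage m B) = (\<Sum>m\<in>M. measure circle (circle_vimage m B))"
      using circle_vimage_in_sets[OF B(1)] disj that
      by (intro finite_measure_finite_Union) (auto simp: disjoint_family_on_def subset_iff)
    also have "\<dots> = (\<Sum>m\<in>M. measure circle B)"
      using that PS by (intro sum.cong measure_circle_vimage[OF B(1)]) (auto intro!: Nat.gr0I)
    finally show ?thesis by simp
  qed
  have mE: "measure circle E = real (card S) * measure circle B"
    and mG: "measure circle G = real (card P) * measure circle B"
    unfolding E_def G_def by (rule level; blast)+
  show ?thesis
  proof (rule that[OF q])
    show "E \<in> sets circle" unfolding E_def using PS circle_vimage_in_sets[OF B(1)] by auto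
    show "first_digit_set q G" unfolding G_def by (intro first_digit_set_UN digit) auto
    show "measure circle G > 0" unfolding mG using PS B by (simp add: card_gt_0_iff)
    have "real K * real (card S) \<le> 2 * real (card P)"
      using PS(6) by (metis of_nat_le_iff of_nat_mult of_nat_numeral)
    then show "real K * measure circle E \<le> 2 * measure circle G"
      unfolding mE mG using B(2) mult_right_mono[of "real K * real (card S)" "2 * real (card P)" "measure circle B"]
      by (simp add: mult_ac)
    fix x assume "x \<in> G"
    then obtain m where m: "m \<in> P" "circle_mult m x \<in> B" by (auto simp: G_def circle_vimage_def)
    have "{n \<in> {1..N}. lam n dvd m \<and> m div lam n \<in> S} \<subseteq> {n \<in> {1..N}. circle_mult (lam n) x \<in> E}" for N
    proof
      fix n assume n: "n \<in> {n \<in> {1..N}. lam n dvd m \<and> m div lam n \<in> S}"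
      then have "m div lam n * lam n = m" by simp
      then have "circle_mult (m div lam n) (circle_mult (lam n) x) = circle_mult m x"
        by (simp add: circle_mult_circle_mult)
      then have "circle_mult (lam n) x \<in> circle_vimage (m div lam n) B"
        using m(2) circle_mult_in_circle[of "lam n" x] by (simp add: circle_vimage_def)
      then show "n \<in> {n \<in> {1..N}. circle_mult (lam n) x \<in> E}" using n by (auto simp: E_def)
    qed
    then have "card {n \<in> {1..N}. lam n dvd m \<and> m div lam n \<in> S} \<le> visits lam E N x" for N
      unfolding visits_def by (intro card_mono) auto
    then show "\<exists>N\<ge>N0. N > 0 \<and> \<delta> / 2 * real N \<le> real (visits lam E N x)"
      using hit[OF m(1)] by (meson of_nat_le_iff order_trans)
  qed
qed

text \<open>With \<open>g\<close> the measure of \<open>G\<close>, about \<open>1/g\<close> independent copies of \<open>G\<close> cover half of the circle. The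
  corresponding copies of \<open>E\<close> have total measure of order \<open>1/K\<close>, whatever \<open>g\<close> is.\<close>

lemma sweeping_half_circle:
  fixes lam :: "nat \<Rightarrow> nat" and \<delta> \<epsilon> :: real
  assumes new: "has_new_primes lam D"
    and \<delta>: "\<delta> > 0" and dense: "\<And>N. N \<ge> N1 \<Longrightarrow> \<delta> * real N \<le> real (card (D \<inter> {1..N}))"
    and \<epsilon>: "\<epsilon> > 0"
  shows "\<exists>E G. E \<in> sets circle \<and> G \<in> sets circle \<and> measure circle E \<le> \<epsilon> \<and> measure circle G \<ge> 1 / 2 \<and>
    (\<forall>x\<in>G. \<exists>N\<ge>N0. N > 0 \<and> \<delta> / 2 * real N \<le> real (visits lam E N x))"
proof -
  interpret prob_space circle by (rule prob_space_circle)
  define K where "K = Suc (nat \<lceil>4 / \<epsilon>\<rceil>)"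
  have K: "K > 0" "4 / \<epsilon> \<le> real K" by (auto simp: K_def) linarith
  obtain E G q where q: "q > 0" and E: "E \<in> sets circle" and G: "first_digit_set q G" "measure circle G > 0"
    and ratio: "real K * measure circle E \<le> 2 * measure circle G"
    and hit: "\<And>x. x \<in> G \<Longrightarrow> \<exists>N\<ge>N0. N > 0 \<and> \<delta> / 2 * real N \<le> real (visits lam E N x)"
    by (rule sweeping_sets[OF new \<delta> dense K(1), where ?N0.0 = N0]) (assumption | rule that)+
  define g where "g = measure circle G"
  have g: "0 < g" "g \<le> 1" using G by (auto simp: g_def)
  define r where "r = nat \<lceil>1 / g\<rceil>"
  have r: "1 / g \<le> real r" "real r \<le> 1 / g + 1" unfolding r_def using g by (simp_all add: real_nat_ceiling_ge)
  define E' where "E' = (\<Union>i<r. circle_vimage (q ^ i) E)"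
  define G' where "G' = (\<Union>i<r. circle_vimage (q ^ i) G)"
  have Gs: "G \<in> sets circle" using first_digit_set_in_sets[OF G(1) q] .
  have E's: "E' \<in> sets circle" and G's: "G' \<in> sets circle"
    unfolding E'_def G'_def using circle_vimage_in_sets[OF E] circle_vimage_in_sets[OF Gs] by auto
  have "measure circle E' \<le> (\<Sum>i<r. measure circle (circle_vimage (q ^ i) E))"
    unfolding E'_def using circle_vimage_in_sets[OF E] by (intro finite_measure_subadditive_finite) auto
  also have "\<dots> = real r * measure circle E" using q by (simp add: measure_circle_vimage[OF E])
  also have "\<dots> \<le> \<epsilon>"
  proof -
    have "real r \<le> 2 / g" using r(2) g by (simp add: field_simps)
    then have "real r * measure circle E \<le> 2 / g * measure circle E" by (intro mult_right_mono) auto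
    moreover have "measure circle E \<le> 2 * g / real K" using ratio K(1) by (simp add: g_def field_simps)
    then have "2 / g * measure circle E \<le> 2 / g * (2 * g / real K)" using g by (intro mult_left_mono) auto
    moreover have "2 / g * (2 * g / real K) = 4 / real K" using g by simp
    moreover have "4 / real K \<le> \<epsilon>" using K \<epsilon> by (simp add: field_simps)
    ultimately show ?thesis by linarith
  qed
  finally have mE': "measure circle E' \<le> \<epsilon>" .
  \<comment> \<open>Since \<open>(1 - g)\<^sup>r (1 + g)\<^sup>r \<le> 1\<close>, it suffices that \<open>(1 + g)\<^sup>r \<ge> 1 + r g \<ge> 2\<close>.\<close>
  have "(1 - g) ^ r \<le> 1 / 2"
  proof -
    have "2 \<le> 1 + real r * g" using r(1) g by (simp add: field_simps)
    also have "\<dots> \<le> (1 + g) ^ r" using g by (intro Bernoulli_inequality) auto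
    finally have "(1 - g) ^ r * 2 \<le> (1 - g) ^ r * (1 + g) ^ r" using g by (intro mult_left_mono) auto
    also have "\<dots> = (1 - g\<^sup>2) ^ r" by (simp add: power2_eq_square algebra_simps flip: power_mult_distrib)
    also have "\<dots> \<le> 1" using g by (intro power_le_one) (auto simp: power_le_one)
    finally show ?thesis by simp
  qed
  moreover have "measure circle ({0..<1} - G') = (1 - g) ^ r"
    unfolding G'_def g_def using measure_avoid_digits[OF G(1) q] by blast
  moreover have "measure circle ({0..<1} - G') = 1 - measure circle G'" using prob_compl[OF G's] by simp
  ultimately have mG': "measure circle G' \<ge> 1 / 2" by linarith
  have "\<exists>N\<ge>N0. N > 0 \<and> \<delta> / 2 * real N \<le> real (visits lam E' N x)" if x: "x \<in> G'" for x
  proof -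
    obtain i where i: "i < r" "circle_mult (q ^ i) x \<in> G" using x by (auto simp: G'_def circle_vimage_def)
    obtain N where N: "N \<ge> N0" "N > 0" "\<delta> / 2 * real N \<le> real (visits lam E N (circle_mult (q ^ i) x))"
      using hit[OF i(2)] by blast
    have "visits lam E N (circle_mult (q ^ i) x) \<le> visits lam E' N x"
      unfolding visits_circle_vimage[symmetric] E'_def using i by (intro visits_mono) auto
    then have "real (visits lam E N (circle_mult (q ^ i) x)) \<le> real (visits lam E' N x)" by simp
    with N show ?thesis by (meson order_trans)
  qed
  then show ?thesis using E's G's mE' mG' by blast
qed

section \<open>Failure of the Khintchin property\<close>

lemma in_Lq_indicator:
  assumes "E \<in> sets circle"
  shows "in_Lq q (\<lambda>x. complex_of_real (indicator E x))"
proof -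
  interpret prob_space circle by (rule prob_space_circle)
  have meas [measurable]: "(\<lambda>x. complex_of_real (indicator E x)) \<in> borel_measurable circle"
    using assms by measurable
  have "(\<lambda>x. norm (complex_of_real (indicator E x)) powr enn2real q) = indicator E"
    by (auto simp: indicator_def fun_eq_iff)
  then have "integrable circle (\<lambda>x. norm (complex_of_real (indicator E x)) powr enn2real q)"
    using assms by (simp add: emeasure_eq_measure)
  then show ?thesis
    unfolding in_Lq_def using meas by (auto simp: indicator_def intro!: exI[of _ 1])
qed

lemma ergodic_avg_indicator:
  "Re (ergodic_avg lam (\<lambda>x. complex_of_real (indicator E x)) N x) = real (visits lam E N x) / real N"
proof -
  have "(\<Sum>n=1..N. complex_of_real (indicator E (circle_mult (lam n) x))) = of_nat (visits lam E N x)"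
    unfolding visits_def by (simp add: indicator_def sum.If_cases Int_def of_real_sum[symmetric] del: of_real_sum)
  then show ?thesis unfolding ergodic_avg_def by (simp add: Re_divide_of_nat)
qed

text \<open>The sets \<open>E k\<close> have total measure below \<open>\<delta>/2\<close>, and every point of the limes superior of the \<open>G k\<close>,
  which has measure at least \<open>1/2\<close>, has averages at least \<open>\<delta>/2\<close> at arbitrarily late times.\<close>

lemma not_Khintchin_if_has_new_primes:
  fixes lam :: "nat \<Rightarrow> nat" and \<delta> :: real
  assumes new: "has_new_primes lam D"
    and \<delta>: "\<delta> > 0" and dense: "\<And>N. N \<ge> N1 \<Longrightarrow> \<delta> * real N \<le> real (card (D \<inter> {1..N}))"
  shows "\<not> Khintchin q lam"
proof
  assume Kh: "Khintchin q lam"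
  interpret prob_space circle by (rule prob_space_circle)
  define \<epsilon> where "\<epsilon> k = \<delta> / 8 * (1 / 2) ^ k" for k :: nat
  have "\<forall>k. \<exists>E G. E \<in> sets circle \<and> G \<in> sets circle \<and> measure circle E \<le> \<epsilon> k \<and> measure circle G \<ge> 1 / 2 \<and>
    (\<forall>x\<in>G. \<exists>N\<ge>k. N > 0 \<and> \<delta> / 2 * real N \<le> real (visits lam E N x))"
    using \<delta> by (intro allI sweeping_half_circle[OF new \<delta> dense]) (auto simp: \<epsilon>_def)
  then obtain E G where sets: "\<And>k. E k \<in> sets circle" "\<And>k. G k \<in> sets circle"
    and mE: "\<And>k. measure circle (E k) \<le> \<epsilon> k" and mG: "\<And>k. measure circle (G k) \<ge> 1 / 2"
    and hit: "\<And>k x. x \<in> G k \<Longrightarrow> \<exists>N\<ge>k. N > 0 \<and> \<delta> / 2 * real N \<le> real (visits lam (E k) N x)"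
    by metis
  define U where "U = (\<Union>k. E k)"
  have U: "U \<in> sets circle" unfolding U_def using sets by auto
  have \<epsilon>_sums: "\<epsilon> sums (\<delta> / 8 * 2)"
    unfolding \<epsilon>_def using geometric_sums[of "1 / 2 :: real"] by (intro sums_mult) simp
  have summ: "summable (\<lambda>k. measure circle (E k))"
    using mE by (intro summable_comparison_test'[OF sums_summable[OF \<epsilon>_sums], of 0]) auto
  have "measure circle U \<le> (\<Sum>k. measure circle (E k))"
    unfolding U_def using sets summ by (intro finite_measure_subadditive_countably) auto
  also have "\<dots> \<le> \<delta> / 8 * 2"
    using suminf_le[OF mE summ sums_summable[OF \<epsilon>_sums]] sums_unique[OF \<epsilon>_sums] by simp
  finally have mU: "measure circle U < \<delta> / 2" using \<delta> by simp
  have int: "(\<integral>x. complex_of_real (indicator U x) \<partial>circle) = complex_of_real (measure circle U)"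
  proof -
    have "U \<inter> space circle = U" using sets.sets_into_space[OF U] by blast
    then show ?thesis by (simp add: integral_complex_of_real)
  qed
  define A where "A n = (\<Union>k\<in>{n..}. G k)" for n
  have A: "A n \<in> sets circle" for n unfolding A_def using sets by auto
  have "measure circle (A n) \<ge> 1 / 2" for n
  proof -
    have "measure circle (G n) \<le> measure circle (A n)"
      using A by (intro finite_measure_mono) (auto simp: A_def)
    then show ?thesis using mG[of n] by linarith
  qed
  moreover have "(\<lambda>n. measure circle (A n)) \<longlonglongrightarrow> measure circle (\<Inter>n. A n)"
  proof (rule finite_Lim_measure_decseq)
    show "decseq A" unfolding decseq_def A_def by (intro allI impI UN_mono) auto
  qed (use A in auto)
  ultimately have big: "measure circle (\<Inter>n. A n) \<ge> 1 / 2" by (intro LIMSEQ_le_const) auto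
  have "AE x in circle. (\<lambda>N. ergodic_avg lam (\<lambda>x. complex_of_real (indicator U x)) N x)
      \<longlonglongrightarrow> complex_of_real (measure circle U)"
    using Kh in_Lq_indicator[OF U, of q] unfolding Khintchin_def int[symmetric] by blast
  then have "AE x in circle. x \<notin> (\<Inter>n. A n)"
  proof eventually_elim
    case (elim x)
    from tendsto_Re[OF elim]
    have "(\<lambda>N. real (visits lam U N x) / real N) \<longlonglongrightarrow> measure circle U"
      by (simp add: ergodic_avg_indicator)
    then have "eventually (\<lambda>N. real (visits lam U N x) / real N < \<delta> / 2) sequentially"
      using mU by (rule order_tendstoD)
    then obtain n where n: "\<And>N. N \<ge> n \<Longrightarrow> real (visits lam U N x) / real N < \<delta> / 2"
      by (auto simp: eventually_sequentially)
    show ?case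
    proof
      assume "x \<in> (\<Inter>n. A n)"
      then obtain k where k: "k \<ge> n" "x \<in> G k" by (auto simp: A_def)
      then obtain N where N: "N \<ge> k" "N > 0" "\<delta> / 2 * real N \<le> real (visits lam (E k) N x)"
        using hit by blast
      have "real (visits lam (E k) N x) \<le> real (visits lam U N x)"
        by (simp add: U_def visits_mono UN_upper)
      then have "\<delta> / 2 \<le> real (visits lam U N x) / real N" using N by (simp add: field_simps)
      with n[of N] N k show False by linarith
    qed
  qed
  then have "measure circle (\<Inter>n. A n) = 0"
    using A by (subst (asm) AE_iff_null_sets[symmetric]) (auto intro: measure_eq_0_null_sets)
  with big show False by simp
qed

section \<open>The sequences \<open>a\<^sup>n - b\<^sup>n\<close> and \<open>a\<^sup>n + b\<^sup>n\<close>\<close>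

lemma dense_sparse_indices:
  assumes "N \<ge> 12 * h"
  shows "1 / 4 * real N \<le> real (card ({n. h \<le> n \<and> 0 < n \<and> odd_prime_weight n \<le> 3 / 8} \<inter> {1..N}))"
proof -
  let ?D = "{n. h \<le> n \<and> 0 < n \<and> odd_prime_weight n \<le> 3 / 8}"
  have "{n \<in> {1..N}. odd_prime_weight n \<le> 3 / 8} \<subseteq> (?D \<inter> {1..N}) \<union> {..<h}" by auto
  then have "card {n \<in> {1..N}. odd_prime_weight n \<le> 3 / 8} \<le> card ((?D \<inter> {1..N}) \<union> {..<h})"
    by (intro card_mono) auto
  also have "\<dots> \<le> card (?D \<inter> {1..N}) + h" using card_Un_le[of "?D \<inter> {1..N}" "{..<h}"] by simp
  finally show ?thesis using card_odd_prime_weight_le[of N] assms by linarith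
qed

lemma eventually_size_condition:
  assumes "a \<ge> (2::nat)"
  obtains h where "\<And>n. n \<ge> h \<Longrightarrow> 2 * real a ^ 2 * real n < real a powr (real n / 8)"
proof -
  define c where "c = 2 * real a ^ 2"
  have c: "c > 0" using assms by (simp add: c_def)
  have "eventually (\<lambda>n. c * real n < 2 powr (real n / 8)) at_top" using c by real_asymp
  then obtain h where h: "\<And>n. n \<ge> h \<Longrightarrow> c * real n < 2 powr (real n / 8)"
    by (auto simp: eventually_at_top_linorder)
  have "2 * real a ^ 2 * real n < real a powr (real n / 8)" if "n \<ge> h" for n
    using h[OF that] powr_mono2[of "real n / 8" 2 "real a"] assms by (simp add: c_def)
  then show ?thesis using that by blast
qed

lemma power_diff_not_Khintchin:
  fixes a b :: nat
  assumes ab: "a > b" "b \<ge> 1" "coprime a b"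
  shows "\<not> Khintchin q (\<lambda>n. a ^ n - b ^ n)"
proof -
  obtain h where h: "\<And>n. n \<ge> h \<Longrightarrow> 2 * real a ^ 2 * real n < real a powr (real n / 8)"
    using eventually_size_condition[of a] ab by auto
  define D where "D = {n. h \<le> n \<and> 0 < n \<and> odd_prime_weight n \<le> 3 / 8}"
  have "has_new_primes (\<lambda>n. a ^ n - b ^ n) D"
    unfolding has_new_primes_def
  proof (intro ballI conjI)
    fix n assume n: "n \<in> D"
    then show "0 < a ^ n - b ^ n" using ab power_strict_mono[of b a n] by (auto simp: D_def)
    have "(\<Sum>q\<in>prime_factors n. 1 / real q) \<le> 7 / 8"
      using sum_inverse_prime_factors_le[of n] n by (simp add: D_def)
    then obtain p where "prime p" "p dvd a ^ n - b ^ n"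
      "\<And>m. 0 < m \<Longrightarrow> m < n \<Longrightarrow> \<not> p dvd a ^ m - b ^ m"
      using primitive_prime_exists[OF ab _ _ h[of n]] n by (auto simp: D_def)
    then show "\<exists>p. prime p \<and> p dvd a ^ n - b ^ n \<and> (\<forall>m\<in>D. m < n \<longrightarrow> \<not> p dvd a ^ m - b ^ m)"
      by (auto simp: D_def)
  qed
  then show ?thesis
    by (rule not_Khintchin_if_has_new_primes[where \<delta> = "1 / 4" and ?N1.0 = "12 * h"])
       (use dense_sparse_indices[of h] in \<open>auto simp: D_def\<close>)
qed

text \<open>A prime dividing \<open>a\<^bsup>2n\<^esup> - b\<^bsup>2n\<^esup> = (a\<^sup>n - b\<^sup>n) (a\<^sup>n + b\<^sup>n)\<close> for the first time divides the second factor,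
  and no \<open>a\<^sup>m + b\<^sup>m\<close> with \<open>m < n\<close>, since this is a factor of \<open>a\<^bsup>2m\<^esup> - b\<^bsup>2m\<^esup>\<close>.\<close>

lemma power_add_not_Khintchin:
  fixes a b :: nat
  assumes ab: "a > b" "b \<ge> 1" "coprime a b"
  shows "\<not> Khintchin q (\<lambda>n. a ^ n + b ^ n)"
proof -
  obtain h where h: "\<And>n. n \<ge> h \<Longrightarrow> 2 * real a ^ 2 * real n < real a powr (real n / 8)"
    using eventually_size_condition[of a] ab by auto
  define D where "D = {n. h \<le> n \<and> 0 < n \<and> odd_prime_weight n \<le> 3 / 8}"
  have factor: "a ^ (2 * m) - b ^ (2 * m) = (a ^ m - b ^ m) * (a ^ m + b ^ m)" for m
  proof -
    have "b ^ m \<le> a ^ m" using ab by (intro power_mono) auto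
    then obtain d where "a ^ m = b ^ m + d" using le_Suc_ex by blast
    then show ?thesis unfolding mult_2 power_add by (simp add: algebra_simps)
  qed
  have "has_new_primes (\<lambda>n. a ^ n + b ^ n) D"
    unfolding has_new_primes_def
  proof (intro ballI conjI)
    fix n assume n: "n \<in> D"
    then have n0: "n > 0" "2 * n \<ge> h" by (auto simp: D_def)
    show "0 < a ^ n + b ^ n" using ab by simp
    have "(\<Sum>q\<in>prime_factors (2 * n). 1 / real q) \<le> 7 / 8"
      using sum_inverse_prime_factors_le[of "2 * n"] odd_prime_weight_double[OF n0(1)] n
      by (simp add: D_def)
    then obtain p where p: "prime p" "p dvd a ^ (2 * n) - b ^ (2 * n)"
      "\<And>m. 0 < m \<Longrightarrow> m < 2 * n \<Longrightarrow> \<not> p dvd a ^ m - b ^ m"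
      using primitive_prime_exists[OF ab _ _ h[OF n0(2)]] n0 by auto
    have "p dvd a ^ n + b ^ n"
      using p n0 unfolding factor by (auto simp: prime_dvd_mult_iff)
    moreover have "\<not> p dvd a ^ m + b ^ m" if "m \<in> D" "m < n" for m
    proof
      assume "p dvd a ^ m + b ^ m"
      then have "p dvd a ^ (2 * m) - b ^ (2 * m)" unfolding factor by simp
      then show False using p(3)[of "2 * m"] that by (auto simp: D_def)
    qed
    ultimately show "\<exists>p. prime p \<and> p dvd a ^ n + b ^ n \<and> (\<forall>m\<in>D. m < n \<longrightarrow> \<not> p dvd a ^ m + b ^ m)"
      using p(1) by blast
  qed
  then show ?thesis
    by (rule not_Khintchin_if_has_new_primes[where \<delta> = "1 / 4" and ?N1.0 = "12 * h"])
       (use dense_sparse_indices[of h] in \<open>auto simp: D_def\<close>)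
qed

theorem corollary4p4:
  shows "(\<forall>a b :: nat. a > b \<and> b \<ge> 1 \<and> gcd a b = 1 \<longrightarrow>
            (\<exists>h. \<not> Khintchin \<infinity> (delete_initial h (\<lambda>n. a ^ n - b ^ n))
               \<and> \<not> Khintchin 1 (delete_initial h (\<lambda>n. a ^ n - b ^ n))) \<and>
            (\<exists>h. \<not> Khintchin \<infinity> (delete_initial h (\<lambda>n. a ^ n + b ^ n))
               \<and> \<not> Khintchin 1 (delete_initial h (\<lambda>n. a ^ n + b ^ n))))
         \<and> \<not> Khintchin \<infinity> (\<lambda>n. 2 ^ n + 1) \<and> \<not> Khintchin 1 (\<lambda>n. 2 ^ n + 1)"
proof (intro conjI allI impI)
  fix a b :: nat
  assume "a > b \<and> b \<ge> 1 \<and> gcd a b = 1"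
  then have ab: "a > b" "b \<ge> 1" "coprime a b"
    unfolding coprime_iff_gcd_eq_1 by blast+
  show "\<exists>h. \<not> Khintchin \<infinity> (delete_initial h (\<lambda>n. a ^ n - b ^ n))
      \<and> \<not> Khintchin 1 (delete_initial h (\<lambda>n. a ^ n - b ^ n))"
    unfolding Khintchin_delete_initial
    by (intro exI[of _ 0] conjI power_diff_not_Khintchin ab)
  show "\<exists>h. \<not> Khintchin \<infinity> (delete_initial h (\<lambda>n. a ^ n + b ^ n))
      \<and> \<not> Khintchin 1 (delete_initial h (\<lambda>n. a ^ n + b ^ n))"
    unfolding Khintchin_delete_initial
    by (intro exI[of _ 0] conjI power_add_not_Khintchin ab)
next
  have "\<not> Khintchin q (\<lambda>n. 2 ^ n + 1)" for q
    using power_add_not_Khintchin[of 1 2 q] by simp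
  then show "\<not> Khintchin \<infinity> (\<lambda>n. 2 ^ n + 1)" "\<not> Khintchin 1 (\<lambda>n. 2 ^ n + 1)" by this+
qed

end
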